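(* Let $A$ be a (possibly unbounded) scalar type spectral operator in a complex Banach space $(X,\|\cdot\|)$. Suppose that for every weak solution $y:[0,\infty)\to X$ of the evolution equation $y'(t)=Ay(t)$, $t\ge 0$, there is a number $\beta$ with $0\le\beta<1$ (depending on $y$) such that $y$ (restricted to $(0,\infty)$) belongs to the $\beta$th-order Roumieu type Gevrey class ${\mathscr E}^{\{\beta\}}((0,\infty),X)$. Then the operator $A$ is bounded, and hence all weak solutions of $y'(t)=Ay(t)$, $t\ge 0$, are necessarily entire vector functions of exponential type.
   Context: **Scalar type spectral operator.** A densely defined closed linear operator $A$ with domain $D(A)$ in a complex Banach space $(X,\|\cdot\|)$ is a scalar type spectral operator if there is a spectral measure (resolution of the identity) $E_A(\cdot)$ assigning to each Borel set $\delta\subseteq\mathbb{C}$ a bounded projection operator $E_A(\delta)$ on $X$, with $E_A(\emptyset)=0$, $E_A(\mathbb{C})=I$, $E_A(\delta)E_A(\sigma)=E_A(\delta\cap\sigma)$ for all Borel $\delta,\sigma$, strongly $\sigma$-additive, having the spectrum $\sigma(A)$ as its support, and such that $A=\int_{\sigma(A)}\lambda\,dE_A(\lambda)$. Here, for a Borel measurable function $F:\sigma(A)\to\mathbb{C}$, the operator $F(A)=\int_{\sigma(A)}F(\lambda)\,dE_A(\lambda)$ is defined by $F(A)f:=\lim_{n\to\infty}F_n(A)f$ on the domain $D(F(A)):=\{f\in X : \lim_{n\to\infty}F_n(A)f \text{ exists}\}$, where $F_n:=F\cdot\chi_{\{\lambda\in\sigma(A):|F(\lambda)|\le n\}}$,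 $n\in\mathbb{N}$, and $F_n(A)=\int_{\sigma(A)}F_n(\lambda)\,dE_A(\lambda)$ is the usual bounded operator obtained by integrating a bounded Borel function with respect to $E_A$. The operator $A$ is bounded if $D(A)=X$ and $A$ is a bounded linear operator on $X$. **Weak solution.** A strongly continuous (norm continuous) function $y:[0,\infty)\to X$ is a weak solution of $y'(t)=Ay(t)$, $t\ge 0$, if for every $g^*\in D(A^* )$, $$\frac{d}{dt}\langle y(t),g^*\rangle=\langle y(t),A^*g^*\rangle,\quad t\ge 0,$$ where $A^*$ is the adjoint of $A$ and $\langle\cdot,\cdot\rangle$ is the pairing between $X$ and its dual $X^*$. **Gevrey classes of functions.** For an interval $I\subseteq(-\infty,\infty)$ and $0\le\beta<\infty$, let $C^\infty(I,X)$ be the space of all $X$-valued functions strongly infinitely differentiable on $I$. The $\beta$th-order Roumieu type Gevrey class is $${\mathscr E}^{\{\beta\}}(I,X):=\Bigl\{g\in C^\infty(I,X) : \forall [a,b]\subseteq I\ \exists\alpha>0\ \exists c>0:\ \max_{a\le t\le b}\|g^{(n)}(t)\|\le c\,\alpha^n[n!]^\beta,\ n=0,1,2,\dots\Bigr\}.$$ **Entire of exponential type.** A vector function $y:[0,\infty)\to X$ is an entire vector function of exponential type if it extends to an entire function $y:\mathbb{C}\to X$ for which there are $\gamma>0$ and $M>0$ with $\|y(z)\|\le Me^{\gamma|z|}$ for all $z\in\mathbb{C}$. *)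

theory Defs
  imports "HOL-Analysis.Analysis"
begin

class complex_banach = banach +
  fixes scaleC :: "complex \<Rightarrow> 'a \<Rightarrow> 'a" (infixr \<open>*\<^sub>C\<close> 75)
  assumes scaleC_add_right: "c *\<^sub>C (x + y) = c *\<^sub>C x + c *\<^sub>C y"
    and scaleC_add_left: "(c + d) *\<^sub>C x = c *\<^sub>C x + d *\<^sub>C x"
    and scaleC_scaleC: "c *\<^sub>C (d *\<^sub>C x) = (c * d) *\<^sub>C x"
    and scaleC_one: "1 *\<^sub>C x = x"
    and scaleC_of_real: "complex_of_real r *\<^sub>C x = r *\<^sub>R x"
    and norm_scaleC: "norm (c *\<^sub>C x) = cmod c * norm x"

instantiation complex :: complex_banach
begin

definition scaleC_complex :: "complex \<Rightarrow> complex \<Rightarrow> complex" where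
  "scaleC_complex c x = c * x"

instance
  by standard
    (simp_all add: scaleC_complex_def algebra_simps norm_mult scaleR_conv_of_real)

end

definition bounded_clinear :: "('a::complex_banach \<Rightarrow> 'b::complex_banach) \<Rightarrow> bool" where
  "bounded_clinear T \<longleftrightarrow> bounded_linear T \<and> (\<forall>c x. T (c *\<^sub>C x) = c *\<^sub>C T x)"

text \<open>
  A possibly unbounded operator is a pair \<open>D\<close>, \<open>A\<close> of a domain and a total function;
  no definition depends on the values of \<open>A\<close> outside \<open>D\<close>.
\<close>

definition linear_operator :: "'a::complex_banach set \<Rightarrow> ('a \<Rightarrow> 'a) \<Rightarrow> bool" where
  "linear_operator D A \<longleftrightarrow>
     0 \<in> D \<and>
     (\<forall>x\<in>D. \<forall>y\<in>D. x + y \<in> D \<and> A (x + y) = A x + A y) \<and>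
     (\<forall>c. \<forall>x\<in>D. c *\<^sub>C x \<in> D \<and> A (c *\<^sub>C x) = c *\<^sub>C A x)"

definition densely_defined_closed_operator ::
    "'a::complex_banach set \<Rightarrow> ('a \<Rightarrow> 'a) \<Rightarrow> bool" where
  "densely_defined_closed_operator D A \<longleftrightarrow>
     linear_operator D A \<and> closure D = UNIV \<and> closed ((\<lambda>x. (x, A x)) ` D)"

definition bounded_operator :: "'a::complex_banach set \<Rightarrow> ('a \<Rightarrow> 'a) \<Rightarrow> bool" where
  "bounded_operator D A \<longleftrightarrow> D = UNIV \<and> bounded_clinear A"

definition resolvent_set :: "'a::complex_banach set \<Rightarrow> ('a \<Rightarrow> 'a) \<Rightarrow> complex set" where
  "resolvent_set D A =
     {z. \<exists>R. bounded_clinear R \<and>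
           (\<forall>x. R x \<in> D \<and> A (R x) - z *\<^sub>C R x = x) \<and>
           (\<forall>x\<in>D. R (A x - z *\<^sub>C x) = x)}"

definition spectrum :: "'a::complex_banach set \<Rightarrow> ('a \<Rightarrow> 'a) \<Rightarrow> complex set" where
  "spectrum D A = - resolvent_set D A"

definition bounded_projection :: "('a::complex_banach \<Rightarrow> 'a) \<Rightarrow> bool" where
  "bounded_projection P \<longleftrightarrow> bounded_clinear P \<and> P \<circ> P = P"

definition spectral_measure :: "(complex set \<Rightarrow> 'a::complex_banach \<Rightarrow> 'a) \<Rightarrow> bool" where
  "spectral_measure E \<longleftrightarrow>
     (\<forall>\<delta>\<in>sets borel. bounded_projection (E \<delta>)) \<and>
     E {} = (\<lambda>_. 0) \<and>
     E UNIV = id \<and>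
     (\<forall>\<delta>\<in>sets borel. \<forall>\<sigma>\<in>sets borel. E \<delta> \<circ> E \<sigma> = E (\<delta> \<inter> \<sigma>)) \<and>
     (\<forall>\<delta> :: nat \<Rightarrow> complex set. range \<delta> \<subseteq> sets borel \<longrightarrow> disjoint_family \<delta> \<longrightarrow>
        (\<forall>f. (\<lambda>n. E (\<delta> n) f) sums E (\<Union>n. \<delta> n) f))"

definition spectral_measure_support ::
    "(complex set \<Rightarrow> 'a::complex_banach \<Rightarrow> 'a) \<Rightarrow> complex set" where
  "spectral_measure_support E = \<Inter>{S. closed S \<and> E (- S) = (\<lambda>_. 0)}"

definition simple_spectral_integral ::
    "(complex set \<Rightarrow> 'a::complex_banach \<Rightarrow> 'a) \<Rightarrow> (complex \<Rightarrow> complex) \<Rightarrow> 'a \<Rightarrow> 'a" where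
  "simple_spectral_integral E s f = (\<Sum>c\<in>range s. c *\<^sub>C E (s -` {c}) f)"

text \<open>
  For bounded Borel \<open>F\<close> the integral is the limit in operator norm of the integrals of
  simple Borel functions converging uniformly to \<open>F\<close>, independently of the approximating sequence.
  The description below is meaningful only for bounded Borel \<open>F\<close>.
\<close>

definition bounded_spectral_integral ::
    "(complex set \<Rightarrow> 'a::complex_banach \<Rightarrow> 'a) \<Rightarrow> (complex \<Rightarrow> complex) \<Rightarrow> 'a \<Rightarrow> 'a" where
  "bounded_spectral_integral E F =
     (THE T. bounded_clinear T \<and>
        (\<forall>s :: nat \<Rightarrow> complex \<Rightarrow> complex.
           (\<forall>n. simple_function borel (s n)) \<longrightarrow> uniform_limit UNIV s F sequentially \<longrightarrow>
           (\<lambda>n. onorm (\<lambda>f. simple_spectral_integral E (s n) f - T f)) \<longlonglongrightarrow> 0))"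

definition spectral_truncation ::
    "complex set \<Rightarrow> (complex \<Rightarrow> complex) \<Rightarrow> nat \<Rightarrow> complex \<Rightarrow> complex" where
  "spectral_truncation S F n z = (if z \<in> S \<and> cmod (F z) \<le> real n then F z else 0)"

definition spectral_integral_domain ::
    "(complex set \<Rightarrow> 'a::complex_banach \<Rightarrow> 'a) \<Rightarrow> complex set \<Rightarrow> (complex \<Rightarrow> complex) \<Rightarrow> 'a set" where
  "spectral_integral_domain E S F =
     {f. convergent (\<lambda>n. bounded_spectral_integral E (spectral_truncation S F n) f)}"

definition spectral_integral ::
    "(complex set \<Rightarrow> 'a::complex_banach \<Rightarrow> 'a) \<Rightarrow> complex set \<Rightarrow> (complex \<Rightarrow> complex) \<Rightarrow> 'a \<Rightarrow> 'a" where
  "spectral_integral E S F f =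
     lim (\<lambda>n. bounded_spectral_integral E (spectral_truncation S F n) f)"

definition scalar_type_spectral_operator ::
    "'a::complex_banach set \<Rightarrow> ('a \<Rightarrow> 'a) \<Rightarrow> bool" where
  "scalar_type_spectral_operator D A \<longleftrightarrow>
     densely_defined_closed_operator D A \<and>
     (\<exists>E. spectral_measure E \<and>
          spectral_measure_support E = spectrum D A \<and>
          D = spectral_integral_domain E (spectrum D A) (\<lambda>z. z) \<and>
          (\<forall>f\<in>D. A f = spectral_integral E (spectrum D A) (\<lambda>z. z) f))"

definition adjoint_domain ::
    "'a::complex_banach set \<Rightarrow> ('a \<Rightarrow> 'a) \<Rightarrow> ('a \<Rightarrow> complex) set" where
  "adjoint_domain D A =
     {g. bounded_clinear g \<and> (\<exists>h. bounded_clinear h \<and> (\<forall>f\<in>D. g (A f) = h f))}"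

definition adjoint_operator ::
    "'a::complex_banach set \<Rightarrow> ('a \<Rightarrow> 'a) \<Rightarrow> ('a \<Rightarrow> complex) \<Rightarrow> ('a \<Rightarrow> complex)" where
  "adjoint_operator D A g = (THE h. bounded_clinear h \<and> (\<forall>f\<in>D. g (A f) = h f))"

text \<open>
  Functions on an interval are total functions on the reals of which only the values on the
  interval matter; derivatives are taken within the interval, hence one-sided at its endpoints.
\<close>

definition weak_solution ::
    "'a::complex_banach set \<Rightarrow> ('a \<Rightarrow> 'a) \<Rightarrow> (real \<Rightarrow> 'a) \<Rightarrow> bool" where
  "weak_solution D A y \<longleftrightarrow>
     continuous_on {0..} y \<and>
     (\<forall>g\<in>adjoint_domain D A. \<forall>t\<ge>0.
        ((\<lambda>s. g (y s)) has_vector_derivative adjoint_operator D A g (y t)) (at t within {0..}))"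

primrec nth_derivative_on ::
    "real set \<Rightarrow> (real \<Rightarrow> 'a::real_normed_vector) \<Rightarrow> nat \<Rightarrow> real \<Rightarrow> 'a" where
  "nth_derivative_on I g 0 = g"
| "nth_derivative_on I g (Suc n) =
     (\<lambda>t. vector_derivative (nth_derivative_on I g n) (at t within I))"

definition smooth_functions_on :: "real set \<Rightarrow> (real \<Rightarrow> 'a::real_normed_vector) set" where
  "smooth_functions_on I = {g. \<forall>n. nth_derivative_on I g n differentiable_on I}"

definition roumieu_gevrey_class ::
    "real \<Rightarrow> real set \<Rightarrow> (real \<Rightarrow> 'a::real_normed_vector) set" where
  "roumieu_gevrey_class \<beta> I =
     {g \<in> smooth_functions_on I.
        \<forall>a b. a \<le> b \<longrightarrow> {a..b} \<subseteq> I \<longrightarrow>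
          (\<exists>\<alpha>>0. \<exists>c>0. \<forall>n. \<forall>t\<in>{a..b}.
             norm (nth_derivative_on I g n t) \<le> c * \<alpha> ^ n * (fact n) powr \<beta>)}"

definition entire_vector_function :: "(complex \<Rightarrow> 'a::complex_banach) \<Rightarrow> bool" where
  "entire_vector_function Y \<longleftrightarrow>
     (\<forall>z. \<exists>L. ((\<lambda>h. inverse h *\<^sub>C (Y (z + h) - Y z)) \<longlongrightarrow> L) (at 0))"

definition entire_of_exponential_type :: "(real \<Rightarrow> 'a::complex_banach) \<Rightarrow> bool" where
  "entire_of_exponential_type y \<longleftrightarrow>
     (\<exists>Y. entire_vector_function Y \<and>
          (\<forall>t\<ge>0. Y (complex_of_real t) = y t) \<and>
          (\<exists>\<gamma>>0. \<exists>M>0. \<forall>z. norm (Y z) \<le> M * exp (\<gamma> * cmod z)))"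

end

theory Submission imports Defs begin

text \<open>
  The spectral measure \<open>E\<close> is uniformly bounded, which yields a bounded multiplicative functional
  calculus for bounded Borel functions. If the spectrum were unbounded, then infinitely many annuli
  \<open>\<Delta>\<^sub>n = {n \<le> |\<lambda>| < n + 1}\<close> would carry unit vectors \<open>e\<^sub>n\<close> in the range of \<open>E(\<Delta>\<^sub>n)\<close>, and
  \<open>y(t) = \<Sum>\<^sub>n e\<^sup>t\<^sup>A e\<^sub>n / n!\<close> would be a weak solution: \<open>1 / n!\<close> beats every \<open>e\<^sup>t\<^sup>n\<close>, wherever in \<open>\<Delta>\<^sub>n\<close> the
  spectrum lies. Projecting the derivatives of \<open>y\<close> at \<open>t = 1\<close> by \<open>E(\<Delta>\<^sub>n)\<close>, a Gevrey bound of order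
  \<open>\<beta>\<close> becomes \<open>n\<^sup>k \<le> Q n! e\<^sup>n \<alpha>\<^sup>k (k!)\<^sup>\<beta>\<close> for all \<open>k\<close>, which for \<open>\<beta> < 1\<close> and \<open>k = m n\<close> with
  \<open>m (1 - \<beta>) \<ge> 2\<close> fails for large \<open>n\<close>. So the spectrum is bounded, hence so is \<open>A\<close>, and the weak
  solutions are the functions \<open>e\<^sup>t\<^sup>A f\<close>.
\<close>

section \<open>Uniform boundedness and spectral measures\<close>

text \<open>The obstacle is the unbounded calculus, with its domains and limits of truncations; the
  proof never builds it. Each operator \<open>A^k e^(zA)\<close> is used only after restriction to a
  bounded Borel set \<open>B\<close>, where it is the integral of a bounded function, and
  \<open>A\<close> itself is met only on vectors fixed by some \<open>E B\<close>, on which the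
  defining truncations are eventually constant. The bounded calculus rests on one estimate: the
  integral of \<open>F\<close> has norm at most \<open>4 * E_bound\<close> times the supremum of
  |F|. The regularity hypothesis enters at three places. Applied to the series solution, it bounds
  the spectrum; applied to a curve with a kink, it shows that bounded functionals separate points;
  applied to an arbitrary weak solution, it supplies a strong derivative for t > 0, so that the
  equation can be integrated.\<close>

lemma bounded_bilinear_scaleC:
  "bounded_bilinear (scaleC :: complex \<Rightarrow> 'a::complex_banach \<Rightarrow> 'a)"
proof
  fix a a' :: complex and b b' :: 'a and r :: real
  show "(a + a') *\<^sub>C b = a *\<^sub>C b + a' *\<^sub>C b"
    by (rule scaleC_add_left)
  show "a *\<^sub>C (b + b') = a *\<^sub>C b + a *\<^sub>C b'"
    by (rule scaleC_add_right)
  show "(r *\<^sub>R a) *\<^sub>C b = r *\<^sub>R (a *\<^sub>C b)"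
    by (metis scaleC_of_real scaleC_scaleC scaleR_conv_of_real)
  show "a *\<^sub>C (r *\<^sub>R b) = r *\<^sub>R (a *\<^sub>C b)"
    by (metis mult.commute scaleC_of_real scaleC_scaleC)
  show "\<exists>K. \<forall>a b. norm (a *\<^sub>C b :: 'a) \<le> norm a * norm b * K"
    by (rule exI[of _ 1]) (simp add: norm_scaleC)
qed

interpretation scaleC: bounded_bilinear "scaleC :: complex \<Rightarrow> 'a::complex_banach \<Rightarrow> 'a"
  by (rule bounded_bilinear_scaleC)

lemma bounded_clinear_imp_bounded_linear: "bounded_clinear T \<Longrightarrow> bounded_linear T"
  by (simp add: bounded_clinear_def)

lemma bounded_clinear_scaleC: "bounded_clinear T \<Longrightarrow> T (c *\<^sub>C x) = c *\<^sub>C T x"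
  by (simp add: bounded_clinear_def)

lemma bounded_clinearI:
  assumes "\<And>x y. T (x + y) = T x + T y"
    and "\<And>c x. T (c *\<^sub>C x) = c *\<^sub>C T x"
    and "\<And>x. norm (T x) \<le> K * norm x"
  shows "bounded_clinear T"
  unfolding bounded_clinear_def
  using assms
  by (auto intro!: bounded_linear_intro[of T K] simp: scaleC_of_real[symmetric] mult.commute)

lemma bounded_clinear_comp:
  "bounded_clinear g \<Longrightarrow> bounded_clinear h \<Longrightarrow> bounded_clinear (\<lambda>x. g (h x))"
  by (auto simp: bounded_clinear_def intro: bounded_linear_compose)

text \<open>Baire: the closed sets \<open>C n\<close> exhaust the space, so one of them contains a
  ball, and differences of its points control every \<open>T i\<close> near 0.\<close>

lemma uniform_boundedness:
  fixes T :: "'i \<Rightarrow> 'a::banach \<Rightarrow> 'b::real_normed_vector"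
  assumes lin: "\<And>i. i \<in> I \<Longrightarrow> bounded_linear (T i)"
    and pt: "\<And>x. \<exists>K. \<forall>i\<in>I. norm (T i x) \<le> K"
  shows "\<exists>K\<ge>0. \<forall>i\<in>I. \<forall>x. norm (T i x) \<le> K * norm x"
proof -
  define C where "C n = {x. \<forall>i\<in>I. norm (T i x) \<le> real n}" for n
  have cl: "closed (C n)" for n
  proof -
    have "C n = (\<Inter>i\<in>I. {x. norm (T i x) \<le> real n})" by (auto simp: C_def)
    moreover have "closed {x. norm (T i x) \<le> real n}" if "i \<in> I" for i
      by (intro closed_Collect_le continuous_on_norm linear_continuous_on lin that continuous_on_const)
    ultimately show ?thesis by auto
  qed
  have U: "(\<Union>n. C n) = UNIV"
  proof (intro set_eqI iffI UNIV_I)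
    fix x
    obtain K where K: "\<forall>i\<in>I. norm (T i x) \<le> K" using pt by blast
    obtain n :: nat where "K \<le> real n" using real_arch_simple by blast
    with K have "x \<in> C n" by (auto simp: C_def intro: order_trans)
    then show "x \<in> (\<Union>n. C n)" by blast
  qed
  have "\<exists>n. interior (C n) \<noteq> {}"
  proof (rule ccontr)
    assume "\<not> ?thesis"
    then have "euclidean interior_of \<Union>(range C) = {}"
      by (intro Baire_category_alt) (auto simp: completely_metrizable_space_euclidean cl)
    then show False using U by auto
  qed
  then obtain n x0 r where r: "r > 0" "ball x0 r \<subseteq> C n"
    by (metis ex_in_conv mem_interior)
  have "norm (T i x) \<le> (4 * real n / r) * norm x" if i: "i \<in> I" for i x
  proof (cases "x = 0")
    case True
    then show ?thesis using lin[OF i] by (simp add: linear_simps)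
  next
    case False
    \<comment> \<open>The displacement \<open>c *\<^sub>R x\<close> has length \<open>r / 2\<close>,
      so it stays in the ball. Two values of norm at most \<open>n\<close> differ by at most
      \<open>2 * n\<close>, and division by \<open>c\<close> produces
      \<open>4 * n / r\<close>.\<close>
    define c where "c = r / (2 * norm x)"
    have c: "c > 0" using r False by (simp add: c_def)
    have "x0 + c *\<^sub>R x \<in> ball x0 r" "x0 \<in> ball x0 r"
      using r False by (auto simp: c_def dist_norm)
    then have "norm (T i (x0 + c *\<^sub>R x)) \<le> n" "norm (T i x0) \<le> n"
      using r(2) i unfolding C_def by blast+
    moreover have "T i (x0 + c *\<^sub>R x) = T i x0 + c *\<^sub>R T i x"
      using lin[OF i] by (simp add: linear_simps)
    ultimately have "norm (c *\<^sub>R T i x) \<le> 2 * real n"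
      using norm_add_leD[of "T i x0" "c *\<^sub>R T i x" n] by simp
    then have "c * norm (T i x) \<le> 2 * real n" using c by simp
    then have "norm (T i x) \<le> 2 * real n / c" using c by (simp add: field_simps)
    also have "\<dots> = (4 * real n / r) * norm x" using False r by (simp add: c_def)
    finally show ?thesis .
  qed
  then show ?thesis using r by (intro exI[of _ "4 * real n / r"]) auto
qed

text \<open>Convexity of the norm takes the place of total variations of scalar measures, so that spectral
  integrals can be estimated without functionals.\<close>

lemma norm_affine_cube_le:
  fixes x :: "'i \<Rightarrow> 'a::real_normed_vector"
  assumes "finite I" and "\<And>J. J \<subseteq> I \<Longrightarrow> norm (v + sum x J) \<le> K"
    and "\<And>i. i \<in> I \<Longrightarrow> 0 \<le> c i \<and> c i \<le> 1"
  shows "norm (v + (\<Sum>i\<in>I. c i *\<^sub>R x i)) \<le> K"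
  using assms
proof (induction I arbitrary: v rule: finite_induct)
  case empty
  then show ?case by auto
next
  case (insert j I)
  let ?s = "\<Sum>i\<in>I. c i *\<^sub>R x i"
  have c: "0 \<le> c j" "c j \<le> 1" using insert.prems by auto
  have 1: "norm (v + ?s) \<le> K"
    using insert.prems by (intro insert.IH) (auto simp: subset_insertI2)
  \<comment> \<open>The shift \<open>v\<close> is arbitrary in the induction so that it can absorb
    \<open>x j\<close>; the coefficient \<open>c j\<close> then mixes the two cases
    convexly.\<close>
  have 2: "norm (v + x j + ?s) \<le> K"
  proof (intro insert.IH)
    fix J assume J: "J \<subseteq> I"
    then have "finite J" "j \<notin> J" using insert.hyps finite_subset by auto
    then show "norm (v + x j + sum x J) \<le> K"
      using insert.prems(1)[of "insert j J"] J by (auto simp: add.assoc)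
  qed (use insert.prems in auto)
  have "v + (\<Sum>i\<in>insert j I. c i *\<^sub>R x i) = (1 - c j) *\<^sub>R (v + ?s) + c j *\<^sub>R (v + x j + ?s)"
    using insert.hyps by (simp add: algebra_simps)
  also have "norm \<dots> \<le> (1 - c j) * norm (v + ?s) + c j * norm (v + x j + ?s)"
    using c by (intro norm_triangle_le) auto
  also have "\<dots> \<le> (1 - c j) * K + c j * K"
    using c 1 2 by (intro add_mono mult_left_mono) auto
  finally show ?case by (simp add: algebra_simps)
qed

text \<open>The factor 4 counts the positive and negative parts of the real and imaginary parts,
  each a combination with coefficients between 0 and \<open>r\<close>. For disjoint pieces of a
  spectral measure the partial sums in the hypothesis are again values of the measure, hence
  bounded.\<close>

lemma norm_complex_combination_le:
  fixes x :: "'i \<Rightarrow> 'a::complex_banach"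
  assumes I: "finite I" and K: "\<And>J. J \<subseteq> I \<Longrightarrow> norm (sum x J) \<le> K"
    and c: "\<And>i. i \<in> I \<Longrightarrow> cmod (c i) \<le> r" and r: "0 \<le> r"
  shows "norm (\<Sum>i\<in>I. c i *\<^sub>C x i) \<le> 4 * K * r"
proof (cases "r = 0")
  case True
  then have "(\<Sum>i\<in>I. c i *\<^sub>C x i) = 0" using c
    by (intro sum.neutral) (auto simp: scaleC.zero_left)
  then show ?thesis using True by simp
next
  case False
  with r have r: "r > 0" by simp
  have *: "norm (\<Sum>i\<in>I. d i *\<^sub>R x i) \<le> K * r" if "\<And>i. i \<in> I \<Longrightarrow> 0 \<le> d i \<and> d i \<le> r" for d
  proof -
    have "norm (0 + (\<Sum>i\<in>I. (d i / r) *\<^sub>R x i)) \<le> K"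
      using that r K I by (intro norm_affine_cube_le) auto
    also have "0 + (\<Sum>i\<in>I. (d i / r) *\<^sub>R x i) = (1 / r) *\<^sub>R (\<Sum>i\<in>I. d i *\<^sub>R x i)"
      by (simp add: scaleR_sum_right)
    finally show ?thesis using r by (simp add: field_simps)
  qed
  let ?a = "\<lambda>i. max 0 (Re (c i))" and ?b = "\<lambda>i. max 0 (- Re (c i))"
    and ?a' = "\<lambda>i. max 0 (Im (c i))" and ?b' = "\<lambda>i. max 0 (- Im (c i))"
  have decomp: "c i *\<^sub>C x i = (?a i *\<^sub>R x i - ?b i *\<^sub>R x i) + \<i> *\<^sub>C (?a' i *\<^sub>R x i - ?b' i *\<^sub>R x i)" for i
  proof -
    have "c i = of_real (?a i) - of_real (?b i) + \<i> * (of_real (?a' i) - of_real (?b' i))"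
      by (auto simp: complex_eq_iff max_def)
    then have "c i *\<^sub>C x i = (of_real (?a i) - of_real (?b i) + \<i> * (of_real (?a' i) - of_real (?b' i))) *\<^sub>C x i"
      by simp
    also have "\<dots> = (?a i *\<^sub>R x i - ?b i *\<^sub>R x i) + \<i> *\<^sub>C (?a' i *\<^sub>R x i - ?b' i *\<^sub>R x i)"
      unfolding scaleC_add_left scaleC.diff_left scaleC_scaleC[symmetric] scaleC_of_real ..
    finally show ?thesis .
  qed
  define s where "s d = (\<Sum>i\<in>I. d i *\<^sub>R x i)" for d
  have "(\<Sum>i\<in>I. c i *\<^sub>C x i) = (s ?a - s ?b) + \<i> *\<^sub>C (s ?a' - s ?b')"
    unfolding decomp s_def by (simp only: sum.distrib sum_subtractf scaleC.sum_right scaleC.diff_right)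
  moreover have "norm ((s ?a - s ?b) + \<i> *\<^sub>C (s ?a' - s ?b'))
      \<le> (norm (s ?a) + norm (s ?b)) + (norm (s ?a') + norm (s ?b'))"
    by (intro norm_triangle_le add_mono) (auto simp: norm_scaleC norm_triangle_ineq4)
  moreover have "(norm (s ?a) + norm (s ?b)) + (norm (s ?a') + norm (s ?b'))
      \<le> (K * r + K * r) + (K * r + K * r)"
  proof -
    have "\<bar>Re (c i)\<bar> \<le> r" "\<bar>Im (c i)\<bar> \<le> r" if "i \<in> I" for i
      using c[OF that] abs_Re_le_cmod[of "c i"] abs_Im_le_cmod[of "c i"] by linarith+
    then show ?thesis
      unfolding s_def using r by (intro add_mono *) (simp_all add: abs_le_iff)
  qed
  ultimately show ?thesis by simp
qed

section \<open>Spectral measures: additivity, null sets, uniform bound\<close>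

locale resolution_of_identity =
  fixes E :: "complex set \<Rightarrow> 'a::complex_banach \<Rightarrow> 'a"
  assumes spectral_measure: "spectral_measure E"
begin

lemma bounded_clinear_E: "\<delta> \<in> sets borel \<Longrightarrow> bounded_clinear (E \<delta>)"
  using spectral_measure by (simp add: spectral_measure_def bounded_projection_def)

lemma bounded_linear_E: "\<delta> \<in> sets borel \<Longrightarrow> bounded_linear (E \<delta>)"
  by (rule bounded_clinear_imp_bounded_linear[OF bounded_clinear_E])

lemma E_empty: "E {} f = 0"
  using spectral_measure by (simp add: spectral_measure_def)

lemma E_UNIV: "E UNIV f = f"
  using spectral_measure by (simp add: spectral_measure_def)

lemma E_E: "\<delta> \<in> sets borel \<Longrightarrow> \<sigma> \<in> sets borel \<Longrightarrow> E \<delta> (E \<sigma> f) = E (\<delta> \<inter> \<sigma>) f"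
  using spectral_measure unfolding spectral_measure_def by (metis comp_apply)

lemma E_sums:
  "range \<delta> \<subseteq> sets borel \<Longrightarrow> disjoint_family \<delta> \<Longrightarrow> (\<lambda>n. E (\<delta> n) f) sums E (\<Union>n. \<delta> n) f"
  for \<delta> :: "nat \<Rightarrow> complex set"
  using spectral_measure by (simp add: spectral_measure_def)

lemma E_Un_disjoint:
  assumes "\<delta> \<in> sets borel" "\<sigma> \<in> sets borel" "\<delta> \<inter> \<sigma> = {}"
  shows "E (\<delta> \<union> \<sigma>) f = E \<delta> f + E \<sigma> f"
proof -
  have "(\<lambda>n. E (binaryset \<delta> \<sigma> n) f) sums E (\<Union>n. binaryset \<delta> \<sigma> n) f"
    using assms
    by (intro E_sums) (auto simp: binaryset_def disjoint_family_on_def)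
  moreover have "(\<lambda>n. E (binaryset \<delta> \<sigma> n) f) sums (E \<delta> f + E \<sigma> f)"
    using sums_finite[of "{0,1}" "\<lambda>n. E (binaryset \<delta> \<sigma> n) f"]
    by (simp add: binaryset_def E_empty)
  ultimately show ?thesis
    by (metis UN_binaryset_eq sums_unique2)
qed

lemma E_UN_finite:
  assumes "finite I" "\<And>i. i \<in> I \<Longrightarrow> \<delta> i \<in> sets borel" "disjoint_family_on \<delta> I"
  shows "E (\<Union>i\<in>I. \<delta> i) f = (\<Sum>i\<in>I. E (\<delta> i) f)"
  using assms
proof (induction I rule: finite_induct)
  case empty
  then show ?case by (simp add: E_empty)
next
  case (insert j I)
  have "E (\<Union>i\<in>insert j I. \<delta> i) f = E (\<delta> j) f + E (\<Union>i\<in>I. \<delta> i) f"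
    unfolding UN_insert
    using insert.prems insert.hyps
    by (intro E_Un_disjoint) (auto simp: disjoint_family_on_def intro!: sets.finite_UN)
  then show ?case
    using insert by (simp add: disjoint_family_on_def)
qed

text \<open>Multiplicativity stands in for the monotonicity of a positive measure:
  \<open>E \<delta>\<close> factors through \<open>E \<sigma>\<close>.\<close>

lemma E_null_subset:
  assumes "E \<sigma> = (\<lambda>_. 0)" "\<delta> \<subseteq> \<sigma>" "\<delta> \<in> sets borel" "\<sigma> \<in> sets borel"
  shows "E \<delta> = (\<lambda>_. 0)"
proof
  fix f
  have "E \<delta> f = E \<delta> (E \<sigma> f)" unfolding E_E[OF assms(3,4)] Int_absorb2[OF assms(2)] ..
  also have "\<dots> = 0" using assms by (simp add: linear_simps bounded_linear_E)
  finally show "E \<delta> f = 0" .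
qed

lemma E_null_UN:
  fixes \<delta> :: "nat \<Rightarrow> complex set"
  assumes "\<And>n. \<delta> n \<in> sets borel" "\<And>n. E (\<delta> n) = (\<lambda>_. 0)"
  shows "E (\<Union>n. \<delta> n) = (\<lambda>_. 0)"
proof
  fix f
  have m: "disjointed \<delta> n \<in> sets borel" for n
    using assms(1) sets.range_disjointed_sets[of \<delta> borel] by blast
  have "(\<lambda>n. E (disjointed \<delta> n) f) sums E (\<Union>n. disjointed \<delta> n) f"
    using m by (intro E_sums disjoint_family_disjointed) auto
  moreover have "E (disjointed \<delta> n) f = 0" for n
    using E_null_subset[OF assms(2) disjointed_subset m assms(1)] by simp
  ultimately show "E (\<Union>n. \<delta> n) f = 0"
    by (metis (no_types, lifting) UN_disjointed_eq sums_cong sums_unique2 sums_zero)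
qed

text \<open>If \<open>E\<close> were unbounded at \<open>f\<close>, then every set \<open>\<delta>\<close> on whose subsets it is unbounded would split
  into two pieces on which \<open>E (\<cdot>) f\<close> has norm at least 1, one of them again of the same kind as
  \<open>\<delta>\<close>. Keeping the other piece at each stage yields a disjoint sequence that violates
  \<open>\<sigma>\<close>-additivity.\<close>

lemma E_pointwise_bounded: "\<exists>K. \<forall>\<delta>\<in>sets borel. norm (E \<delta> f) \<le> K"
proof (rule ccontr)
  assume nb: "\<not> ?thesis"
  define bad where
    "bad \<delta> \<longleftrightarrow> \<delta> \<in> sets borel \<and> (\<forall>K. \<exists>\<sigma>\<in>sets borel. \<sigma> \<subseteq> \<delta> \<and> norm (E \<sigma> f) > K)" for \<delta>
  have badU: "bad UNIV" using nb by (auto simp: bad_def not_le)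
  have step: "\<exists>\<sigma>. bad \<sigma> \<and> \<sigma> \<subseteq> \<delta> \<and> norm (E (\<delta> - \<sigma>) f) \<ge> 1" if \<delta>: "bad \<delta>" for \<delta>
  proof -
    \<comment> \<open>Exceeding \<open>norm (E \<delta> f)\<close> by 1 forces
      \<open>E (\<delta> - \<sigma>) f\<close> to have norm at least 1 as well. Both pieces are thus
      large, and either may be the one that is kept.\<close>
    obtain \<sigma> where \<sigma>: "\<sigma> \<in> sets borel" "\<sigma> \<subseteq> \<delta>" "norm (E \<sigma> f) > norm (E \<delta> f) + 1"
      using \<delta> unfolding bad_def by blast
    have \<delta>b: "\<delta> \<in> sets borel" using \<delta> by (simp add: bad_def)
    have spl: "E \<tau> f = E (\<tau> \<inter> \<sigma>) f + E (\<tau> - \<sigma>) f" if "\<tau> \<in> sets borel" for \<tau>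
      using E_Un_disjoint[of "\<tau> \<inter> \<sigma>" "\<tau> - \<sigma>" f] that \<sigma>(1) by (simp add: Int_Diff_Un Int_Diff_disjoint)
    have "E \<delta> f = E \<sigma> f + E (\<delta> - \<sigma>) f" using spl[OF \<delta>b] \<sigma>(2) by (simp add: Int_absorb1)
    then have n2: "norm (E (\<delta> - \<sigma>) f) \<ge> 1"
      using \<sigma>(3) norm_triangle_ineq2[of "E \<sigma> f" "E \<delta> f"] by simp
    have n1: "norm (E (\<delta> - (\<delta> - \<sigma>)) f) \<ge> 1"
    proof -
      have "\<delta> - (\<delta> - \<sigma>) = \<sigma>" using \<sigma>(2) by blast
      then show ?thesis using \<sigma>(3) norm_ge_zero[of "E \<delta> f"] by (simp del: norm_ge_zero)
    qed
    have "bad \<sigma> \<or> bad (\<delta> - \<sigma>)"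
    proof (rule ccontr)
      assume "\<not> ?thesis"
      then obtain K1 K2 where K: "\<And>\<tau>. \<tau> \<in> sets borel \<Longrightarrow> \<tau> \<subseteq> \<sigma> \<Longrightarrow> norm (E \<tau> f) \<le> K1"
         "\<And>\<tau>. \<tau> \<in> sets borel \<Longrightarrow> \<tau> \<subseteq> \<delta> - \<sigma> \<Longrightarrow> norm (E \<tau> f) \<le> K2"
        using \<sigma>(1) \<delta>b unfolding bad_def by (metis not_le sets.Diff)
      have "norm (E \<tau> f) \<le> K1 + K2" if \<tau>: "\<tau> \<in> sets borel" "\<tau> \<subseteq> \<delta>" for \<tau>
      proof -
        have "norm (E (\<tau> \<inter> \<sigma>) f) \<le> K1" "norm (E (\<tau> - \<sigma>) f) \<le> K2"
          using \<tau> \<sigma>(1) by (auto intro!: K)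
        then show ?thesis unfolding spl[OF \<tau>(1)] by (intro norm_triangle_le) auto
      qed
      then show False using \<delta> unfolding bad_def by (meson not_le)
    qed
    then show ?thesis using n1 n2 \<sigma>(2) by blast
  qed
  obtain s where s: "\<And>n. bad (s n)"
     "\<And>n. s (Suc n) \<subseteq> s n \<and> norm (E (s n - s (Suc n)) f) \<ge> 1"
  proof -
    have "\<exists>s. \<forall>n. bad (s n) \<and> s (Suc n) \<subseteq> s n \<and> norm (E (s n - s (Suc n)) f) \<ge> 1"
      by (rule dependent_nat_choice) (use badU step in auto)
    then show ?thesis using that by auto
  qed
  have anti: "s n \<subseteq> s m" if "m \<le> n" for m n
    using that by (rule lift_Suc_antimono_le[rotated]) (use s in auto)
  have "(\<lambda>n. E (s n - s (Suc n)) f) sums E (\<Union>n. s n - s (Suc n)) f"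
  proof (rule E_sums)
    show "range (\<lambda>n. s n - s (Suc n)) \<subseteq> sets borel" using s(1) by (auto simp: bad_def)
    show "disjoint_family (\<lambda>n. s n - s (Suc n))"
    proof (unfold disjoint_family_on_def, intro ballI impI)
      fix m n :: nat assume "m \<noteq> n"
      then have "s n \<subseteq> s (Suc m) \<or> s m \<subseteq> s (Suc n)"
        using anti by (metis Suc_leI nat_neq_iff)
      then show "(s m - s (Suc m)) \<inter> (s n - s (Suc n)) = {}" by auto
    qed
  qed
  then have "(\<lambda>n. E (s n - s (Suc n)) f) \<longlonglongrightarrow> 0"
    using summable_LIMSEQ_zero sums_summable by blast
  then have "\<forall>\<^sub>F n in sequentially. norm (E (s n - s (Suc n)) f) < 1"
    using tendstoD[OF _ zero_less_one] by (fastforce simp: dist_norm)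
  then show False using s(2) by (meson eventually_sequentially le_refl not_le)
qed

text \<open>One constant for all Borel sets and vectors; Banach-Steinhaus, fed with the pointwise
  bounds just proved, shows that such a choice exists.\<close>

definition E_bound :: real where
  "E_bound = (SOME K. K \<ge> 0 \<and> (\<forall>\<delta>\<in>sets borel. \<forall>f. norm (E \<delta> f) \<le> K * norm f))"

lemma E_bound_nonneg: "E_bound \<ge> 0"
  and norm_E_le: "\<delta> \<in> sets borel \<Longrightarrow> norm (E \<delta> f) \<le> E_bound * norm f"
proof -
  have "\<exists>K. K \<ge> 0 \<and> (\<forall>\<delta>\<in>sets borel. \<forall>f. norm (E \<delta> f) \<le> K * norm f)"
    using uniform_boundedness[of "sets borel" E] bounded_linear_E E_pointwise_bounded by blast
  from someI_ex[OF this]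
  show "E_bound \<ge> 0" "\<delta> \<in> sets borel \<Longrightarrow> norm (E \<delta> f) \<le> E_bound * norm f"
    by (auto simp: E_bound_def)
qed

end

section \<open>The integral of bounded Borel functions\<close>

definition bounded_borel :: "(complex \<Rightarrow> complex) \<Rightarrow> bool" where
  "bounded_borel F \<longleftrightarrow> F \<in> borel_measurable borel \<and> (\<exists>r. \<forall>z. cmod (F z) \<le> r)"

lemma bounded_borelI:
  "F \<in> borel_measurable borel \<Longrightarrow> (\<And>z. cmod (F z) \<le> r) \<Longrightarrow> bounded_borel F"
  unfolding bounded_borel_def by blast

lemma bounded_borelE:
  assumes "bounded_borel F"
  obtains r where "0 \<le> r" "\<And>z. cmod (F z) \<le> r"
proof -
  obtain r where r: "\<And>z. cmod (F z) \<le> r" using assms by (auto simp: bounded_borel_def)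
  then have "0 \<le> r" using norm_ge_zero order_trans by blast
  with r show ?thesis using that by blast
qed

lemma borel_measurable_bounded_borel: "bounded_borel F \<Longrightarrow> F \<in> borel_measurable borel"
  by (simp add: bounded_borel_def)

lemma bounded_borel_add:
  assumes "bounded_borel F" "bounded_borel G"
  shows "bounded_borel (\<lambda>z. F z + G z)"
proof -
  obtain r where "\<And>z. cmod (F z) \<le> r" using assms(1) by (rule bounded_borelE) blast
  moreover obtain q where "\<And>z. cmod (G z) \<le> q" using assms(2) by (rule bounded_borelE) blast
  ultimately show ?thesis
    using assms[THEN borel_measurable_bounded_borel]
    by (intro bounded_borelI[of _ "r + q"]) (simp_all add: norm_triangle_mono)
qed

lemma bounded_borel_mult:
  assumes "bounded_borel F" "bounded_borel G"
  shows "bounded_borel (\<lambda>z. F z * G z)"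
proof -
  obtain r where "0 \<le> r" "\<And>z. cmod (F z) \<le> r" using assms(1) by (rule bounded_borelE) blast
  moreover obtain q where "\<And>z. cmod (G z) \<le> q" using assms(2) by (rule bounded_borelE) blast
  ultimately show ?thesis
    using assms[THEN borel_measurable_bounded_borel]
    by (intro bounded_borelI[of _ "r * q"]) (simp_all add: norm_mult mult_mono')
qed

lemma bounded_borel_const: "bounded_borel (\<lambda>z. c)"
  by (intro bounded_borelI[of _ "cmod c"]) auto

lemma bounded_borel_diff:
  assumes "bounded_borel F" "bounded_borel G"
  shows "bounded_borel (\<lambda>z. F z - G z)"
  using bounded_borel_add[OF assms(1) bounded_borel_mult[OF bounded_borel_const[of "-1"] assms(2)]]
  by simp

lemma bounded_borel_indicator_mult:
  assumes "B \<in> sets borel" "G \<in> borel_measurable borel" "\<And>z. z \<in> B \<Longrightarrow> cmod (G z) \<le> r"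
  shows "bounded_borel (\<lambda>z. indicator B z * G z)"
  using assms
  \<comment> \<open>The product is 0 off \<open>B\<close>, and \<open>r\<close> may be negative when
    \<open>B\<close> is empty; hence \<open>max r 0\<close>.\<close>
  by (intro bounded_borelI[of _ "max r 0"] borel_measurable_times borel_measurable_indicator)
     (auto simp: indicator_def le_max_iff_disj)

lemma simple_function_imp_bounded_borel:
  assumes "simple_function borel s"
  shows "bounded_borel s"
proof -
  have "finite (range s)" using simple_functionD(1)[OF assms] by simp
  then show ?thesis
    by (intro bounded_borelI[of _ "Max (cmod ` range s)"] borel_measurable_simple_function assms) auto
qed

section \<open>Uniform approximation by simple functions\<close>

definition discretize :: "nat \<Rightarrow> (complex \<Rightarrow> complex) \<Rightarrow> complex \<Rightarrow> complex" where
  "discretize n F z =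
     of_real (of_int \<lfloor>Re (F z) * real (Suc n)\<rfloor> / real (Suc n)) +
     \<i> * of_real (of_int \<lfloor>Im (F z) * real (Suc n)\<rfloor> / real (Suc n))"

lemma simple_function_discretize:
  assumes "bounded_borel F"
  shows "simple_function borel (discretize n F)"
proof (rule simple_function_borel_measurable)
  have [measurable]: "F \<in> borel_measurable borel"
    using assms by (rule borel_measurable_bounded_borel)
  have [measurable]: "(\<lambda>z. Re (F z)) \<in> borel_measurable borel" "(\<lambda>z. Im (F z)) \<in> borel_measurable borel"
    by (auto intro!: borel_measurable_Re borel_measurable_Im)
  have "(\<lambda>z. real_of_int \<lfloor>Re (F z) * real (Suc n)\<rfloor> / real (Suc n)) \<in> borel_measurable borel"
    "(\<lambda>z. real_of_int \<lfloor>Im (F z) * real (Suc n)\<rfloor> / real (Suc n)) \<in> borel_measurable borel"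
    by measurable
  then show "discretize n F \<in> borel_measurable borel"
    unfolding discretize_def
    by (intro borel_measurable_add borel_measurable_times borel_measurable_const
        measurable_compose[OF _ borel_measurable_continuous_onI[OF continuous_on_of_real_id]])
next
  obtain r where r: "0 \<le> r" "\<And>z. cmod (F z) \<le> r" using assms by (rule bounded_borelE) blast
  \<comment> \<open>\<open>N\<close> bounds the rounded numerators of both coordinates, so the
    values lie on a finite piece of the grid of mesh \<open>1 / Suc n\<close>.\<close>
  define N where "N = \<lceil>r * real (Suc n)\<rceil>"
  have fl: "\<lfloor>x * real (Suc n)\<rfloor> \<in> {-N..N}" if "\<bar>x\<bar> \<le> r" for x :: real
  proof -
    have "\<bar>x * real (Suc n)\<bar> \<le> r * real (Suc n)"
      using that by (simp add: abs_mult mult_right_mono del: of_nat_Suc)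
    then have "\<bar>x * real (Suc n)\<bar> \<le> of_int N"
      unfolding N_def by (meson le_of_int_ceiling order_trans)
    then show ?thesis by (auto simp: abs_le_iff floor_le_iff le_floor_iff simp del: of_nat_Suc)
  qed
  have "range (discretize n F) \<subseteq>
     (\<lambda>(i, j). of_real (of_int i / real (Suc n)) + \<i> * of_real (of_int j / real (Suc n))) ` ({-N..N} \<times> {-N..N})"
  proof
    fix w assume "w \<in> range (discretize n F)"
    then obtain z where w: "w = discretize n F z" by auto
    have "\<bar>Re (F z)\<bar> \<le> r" "\<bar>Im (F z)\<bar> \<le> r"
      using r(2)[of z] abs_Re_le_cmod[of "F z"] abs_Im_le_cmod[of "F z"] by linarith+
    then show "w \<in> (\<lambda>(i, j). of_real (of_int i / real (Suc n)) + \<i> * of_real (of_int j / real (Suc n))) ` ({-N..N} \<times> {-N..N})"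
      unfolding w discretize_def
      by (intro image_eqI[of _ _ "(\<lfloor>Re (F z) * real (Suc n)\<rfloor>, \<lfloor>Im (F z) * real (Suc n)\<rfloor>)"])
         (simp_all only: prod.case mem_Times_iff fst_conv snd_conv fl conj_absorb)
  qed
  then show "finite (discretize n F ` space borel)"
    by (metis (no_types, lifting) finite_SigmaI finite_atLeastAtMost_int finite_imageI finite_subset space_borel)
qed

text \<open>Rounding down costs at most one mesh width per coordinate. The rate is the same for
  every \<open>F\<close>, so it serves as the error term in the limits below.\<close>

lemma norm_discretize_diff: "cmod (discretize n F z - F z) \<le> 2 / real (Suc n)"
proof -
  have *: "\<bar>of_int \<lfloor>x * real (Suc n)\<rfloor> / real (Suc n) - x\<bar> \<le> 1 / real (Suc n)" for x :: real
  proof -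
    have "\<bar>of_int \<lfloor>x * real (Suc n)\<rfloor> - x * real (Suc n)\<bar> \<le> 1" by linarith
    then have "\<bar>of_int \<lfloor>x * real (Suc n)\<rfloor> - x * real (Suc n)\<bar> / real (Suc n) \<le> 1 / real (Suc n)"
      by (intro divide_right_mono) auto
    also have "\<bar>of_int \<lfloor>x * real (Suc n)\<rfloor> - x * real (Suc n)\<bar> / real (Suc n)
      = \<bar>(of_int \<lfloor>x * real (Suc n)\<rfloor> - x * real (Suc n)) / real (Suc n)\<bar>"
      by (simp del: of_nat_Suc add: abs_divide)
    also have "(of_int \<lfloor>x * real (Suc n)\<rfloor> - x * real (Suc n)) / real (Suc n)
       = of_int \<lfloor>x * real (Suc n)\<rfloor> / real (Suc n) - x"
      by (simp add: diff_divide_distrib del: of_nat_Suc)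
    finally show ?thesis .
  qed
  have "cmod (discretize n F z - F z) \<le>
     \<bar>Re (discretize n F z - F z)\<bar> + \<bar>Im (discretize n F z - F z)\<bar>" by (rule cmod_le)
  also have "\<dots> \<le> 1 / real (Suc n) + 1 / real (Suc n)"
    using *[of "Re (F z)"] *[of "Im (F z)"]
    by (intro add_mono) (simp_all add: discretize_def del: of_nat_Suc)
  finally show ?thesis by simp
qed

lemma uniform_limit_discretize: "uniform_limit UNIV (\<lambda>n. discretize n F) F sequentially"
proof (rule uniform_limitI)
  fix e :: real assume "e > 0"
  have "(\<lambda>n. 2 / real (Suc n)) \<longlonglongrightarrow> 0"
    by (rule LIMSEQ_Suc[OF lim_const_over_n])
  then have "\<forall>\<^sub>F n in sequentially. 2 / real (Suc n) < e"
    using \<open>e > 0\<close> by (rule order_tendstoD)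
  then show "\<forall>\<^sub>F n in sequentially. \<forall>x\<in>UNIV. dist (discretize n F x) (F x) < e"
  proof eventually_elim
    case (elim n)
    then show ?case
      unfolding dist_norm using le_less_trans[OF norm_discretize_diff] by blast
  qed
qed

lemma borel_vimage_simple: "simple_function borel p \<Longrightarrow> p -` V \<in> sets borel"
  for p :: "complex \<Rightarrow> 'b"
  using simple_functionD(2)[of borel p V] by simp

section \<open>Integrals of simple functions and of their uniform limits\<close>

context resolution_of_identity
begin

text \<open>Level sets of \<open>h \<circ> p\<close> are finite disjoint unions of level sets of
  \<open>p\<close>, so the sum may run over the finer partition. With \<open>p\<close> a pair of
  simple functions this gives a common refinement for sums and products.\<close>

lemma simple_spectral_integral_comp:
  fixes p :: "complex \<Rightarrow> 'b"
  assumes p: "simple_function borel p"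
  shows "simple_spectral_integral E (\<lambda>z. h (p z)) f = (\<Sum>v\<in>range p. h v *\<^sub>C E (p -` {v}) f)"
proof -
  have fin: "finite (range p)" using simple_functionD(1)[OF p] by simp
  have "(\<Sum>v\<in>range p. h v *\<^sub>C E (p -` {v}) f)
      = (\<Sum>c\<in>h ` range p. \<Sum>v\<in>{v \<in> range p. h v = c}. h v *\<^sub>C E (p -` {v}) f)"
    by (rule sum.image_gen[OF fin])
  also have "\<dots> = (\<Sum>c\<in>range (\<lambda>z. h (p z)). c *\<^sub>C E ((\<lambda>z. h (p z)) -` {c}) f)"
  proof (rule sum.cong)
    show "h ` range p = range (\<lambda>z. h (p z))" by auto
  next
    fix c
    let ?V = "{v \<in> range p. h v = c}"
    have "(\<Sum>v\<in>?V. h v *\<^sub>C E (p -` {v}) f) = (\<Sum>v\<in>?V. c *\<^sub>C E (p -` {v}) f)" by simp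
    also have "\<dots> = c *\<^sub>C (\<Sum>v\<in>?V. E (p -` {v}) f)" by (simp add: scaleC.sum_right)
    also have "(\<Sum>v\<in>?V. E (p -` {v}) f) = E (\<Union>v\<in>?V. p -` {v}) f"
      using fin borel_vimage_simple[OF p]
      by (intro E_UN_finite[symmetric]) (auto simp: disjoint_family_on_def)
    also have "(\<Union>v\<in>?V. p -` {v}) = (\<lambda>z. h (p z)) -` {c}" by auto
    finally show "(\<Sum>v\<in>?V. h v *\<^sub>C E (p -` {v}) f) = c *\<^sub>C E ((\<lambda>z. h (p z)) -` {c}) f" .
  qed
  finally show ?thesis by (simp add: simple_spectral_integral_def)
qed

lemma simple_spectral_integral_add:
  assumes "simple_function borel s" "simple_function borel t"
  shows "simple_spectral_integral E (\<lambda>z. s z + t z) f =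
    simple_spectral_integral E s f + simple_spectral_integral E t f"
proof -
  let ?p = "\<lambda>z. (s z, t z)"
  have p: "simple_function borel ?p" using assms by (rule simple_function_Pair)
  show ?thesis
    using simple_spectral_integral_comp[OF p, of "\<lambda>v. fst v + snd v" f]
      simple_spectral_integral_comp[OF p, of fst f] simple_spectral_integral_comp[OF p, of snd f]
    by (simp add: scaleC_add_left sum.distrib)
qed

lemma simple_spectral_integral_cmult:
  assumes "simple_function borel s"
  shows "simple_spectral_integral E (\<lambda>z. c * s z) f = c *\<^sub>C simple_spectral_integral E s f"
  using simple_spectral_integral_comp[OF assms, of "\<lambda>v. c * v" f]
  by (simp add: simple_spectral_integral_def scaleC.sum_right scaleC_scaleC)

lemma simple_spectral_integral_mult:
  assumes s: "simple_function borel s" and t: "simple_function borel t"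
  shows "simple_spectral_integral E (\<lambda>z. s z * t z) f =
    simple_spectral_integral E s (simple_spectral_integral E t f)"
proof -
  let ?p = "\<lambda>z. (s z, t z)"
  have p: "simple_function borel ?p" using assms by (rule simple_function_Pair)
  have fin: "finite (range s)" "finite (range t)"
    using simple_functionD(1)[OF s] simple_functionD(1)[OF t] by simp_all
  have vp: "?p -` {(c, d)} = s -` {c} \<inter> t -` {d}" for c d by auto
  have "simple_spectral_integral E s (simple_spectral_integral E t f)
     = (\<Sum>c\<in>range s. \<Sum>d\<in>range t. (c * d) *\<^sub>C E (?p -` {(c, d)}) f)"
    unfolding simple_spectral_integral_def vp
    by (simp add: linear_sum[OF bounded_linear.linear[OF bounded_linear_E]]
        borel_vimage_simple[OF s] borel_vimage_simple[OF t] E_E scaleC.sum_right scaleC_scaleC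
        bounded_clinear_scaleC[OF bounded_clinear_E])
  also have "\<dots> = (\<Sum>v\<in>range s \<times> range t. (fst v * snd v) *\<^sub>C E (?p -` {v}) f)"
    by (simp add: sum.cartesian_product case_prod_beta)
  \<comment> \<open>Pairs that are not attained have an empty preimage and contribute
    \<open>E {} = 0\<close>.\<close>
  also have "\<dots> = (\<Sum>v\<in>range ?p. (fst v * snd v) *\<^sub>C E (?p -` {v}) f)"
  proof (rule sum.mono_neutral_right)
    show "\<forall>v\<in>range s \<times> range t - range ?p. (fst v * snd v) *\<^sub>C E (?p -` {v}) f = 0"
    proof
      fix v assume "v \<in> range s \<times> range t - range ?p"
      then have "?p -` {v} = {}" by blast
      then show "(fst v * snd v) *\<^sub>C E (?p -` {v}) f = 0"
        by (simp only: E_empty scaleC.zero_right)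
    qed
  qed (use fin in auto)
  also have "\<dots> = simple_spectral_integral E (\<lambda>z. s z * t z) f"
    using simple_spectral_integral_comp[OF p, of "\<lambda>v. fst v * snd v" f] by simp
  finally show ?thesis by simp
qed

text \<open>A partial sum over a set \<open>J\<close> of values is \<open>E\<close> of a single
  preimage, so \<open>norm_complex_combination_le\<close> applies with
  \<open>K = E_bound * norm f\<close>. The estimate sees the bound of \<open>s\<close> but not the
  number of its values, which permits uniform limits.\<close>

lemma norm_simple_spectral_integral_le:
  assumes s: "simple_function borel s" and r: "\<And>z. cmod (s z) \<le> r"
  shows "norm (simple_spectral_integral E s f) \<le> 4 * E_bound * r * norm f"
proof -
  have fin: "finite (range s)" using simple_functionD(1)[OF s] by simp
  have "0 \<le> r" using r norm_ge_zero order_trans by blast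
  have "norm (\<Sum>c\<in>range s. c *\<^sub>C E (s -` {c}) f) \<le> 4 * (E_bound * norm f) * r"
  proof (rule norm_complex_combination_le[OF fin])
    fix J assume J: "J \<subseteq> range s"
    then have "(\<Sum>c\<in>J. E (s -` {c}) f) = E (\<Union>c\<in>J. s -` {c}) f"
      using finite_subset[OF J fin] borel_vimage_simple[OF s]
      by (intro E_UN_finite[symmetric]) (auto simp: disjoint_family_on_def)
    also have "(\<Union>c\<in>J. s -` {c}) = s -` J" by auto
    finally show "norm (\<Sum>c\<in>J. E (s -` {c}) f) \<le> E_bound * norm f"
      using norm_E_le borel_vimage_simple[OF s] by simp
  qed (use r \<open>0 \<le> r\<close> in auto)
  then show ?thesis by (simp add: simple_spectral_integral_def mult_ac)
qed

lemma bounded_clinear_simple_spectral_integral: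
  assumes s: "simple_function borel s"
  shows "bounded_clinear (simple_spectral_integral E s)"
proof -
  obtain r where r: "\<And>z. cmod (s z) \<le> r"
    using simple_function_imp_bounded_borel[OF s] by (rule bounded_borelE) blast
  have E: "bounded_clinear (E (s -` {c}))" for c
    by (rule bounded_clinear_E[OF borel_vimage_simple[OF s]])
  show ?thesis
  proof (rule bounded_clinearI)
    fix x y c
    show "simple_spectral_integral E s (x + y) = simple_spectral_integral E s x + simple_spectral_integral E s y"
      by (simp add: simple_spectral_integral_def linear_simps[OF bounded_clinear_imp_bounded_linear[OF E]]
          scaleC_add_right sum.distrib)
    show "simple_spectral_integral E s (c *\<^sub>C x) = c *\<^sub>C simple_spectral_integral E s x"
      by (simp add: simple_spectral_integral_def bounded_clinear_scaleC[OF E] scaleC.sum_right scaleC_scaleC mult.commute)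
    show "norm (simple_spectral_integral E s x) \<le> (4 * E_bound * r) * norm x"
      using s r by (rule norm_simple_spectral_integral_le)
  qed
qed

lemma norm_simple_spectral_integral_diff_le:
  assumes s: "simple_function borel s" and t: "simple_function borel t"
    and r: "\<And>z. cmod (s z - t z) \<le> r"
  shows "norm (simple_spectral_integral E s f - simple_spectral_integral E t f) \<le> 4 * E_bound * r * norm f"
proof -
  have "simple_spectral_integral E (\<lambda>z. s z + (-1) * t z) f
      = simple_spectral_integral E s f + (-1) *\<^sub>C simple_spectral_integral E t f"
    unfolding simple_spectral_integral_add[OF s simple_function_compose1[OF t]]
      simple_spectral_integral_cmult[OF t] ..
  also have "\<dots> = simple_spectral_integral E s f - simple_spectral_integral E t f"
    by (simp add: scaleC.minus_left scaleC_one)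
  finally show ?thesis
    using norm_simple_spectral_integral_le[of "\<lambda>z. s z + (-1) * t z" r f]
      simple_function_compose2[OF s t, of "\<lambda>a b. a + (-1) * b"] r by simp
qed

text \<open>A concrete limit to compute with, in place of the definite description in
  \<open>bounded_spectral_integral\<close>; \<open>bounded_spectral_integral_eq_bint\<close>
  identifies the two.\<close>

definition bint :: "(complex \<Rightarrow> complex) \<Rightarrow> 'a \<Rightarrow> 'a" where
  "bint F f = lim (\<lambda>n. simple_spectral_integral E (discretize n F) f)"

lemma bint_discretize:
  assumes F: "bounded_borel F"
  shows "(\<lambda>n. simple_spectral_integral E (discretize n F) f) \<longlonglongrightarrow> bint F f"
proof -
  let ?X = "\<lambda>n. simple_spectral_integral E (discretize n F) f"
  have d: "norm (?X m - ?X n) \<le> 4 * E_bound * (2 / real (Suc m) + 2 / real (Suc n)) * norm f" for m n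
  proof (rule norm_simple_spectral_integral_diff_le)
    show "cmod (discretize m F z - discretize n F z) \<le> 2 / real (Suc m) + 2 / real (Suc n)" for z
      using norm_discretize_diff[of m F z] norm_discretize_diff[of n F z]
      by (metis add_mono norm_diff_triangle_le norm_minus_commute)
  qed (simp_all add: simple_function_discretize[OF F])
  have "Cauchy ?X"
  proof (rule CauchyI)
    fix e :: real assume e: "e > 0"
    have "(\<lambda>n. 2 / real (Suc n)) \<longlonglongrightarrow> 0"
      by (rule LIMSEQ_Suc[OF lim_const_over_n])
    then have "(\<lambda>n. 4 * E_bound * (2 / real (Suc n) + 2 / real (Suc n)) * norm f) \<longlonglongrightarrow> 4 * E_bound * (0 + 0) * norm f"
      by (intro tendsto_intros)
    then have "\<forall>\<^sub>F n in sequentially. 4 * E_bound * (2 / real (Suc n) + 2 / real (Suc n)) * norm f < e"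
      using e by (intro order_tendstoD) auto
    then obtain N where N: "4 * E_bound * (2 / real (Suc N) + 2 / real (Suc N)) * norm f < e"
      by (auto simp: eventually_sequentially)
    show "\<exists>M. \<forall>m\<ge>M. \<forall>n\<ge>M. norm (?X m - ?X n) < e"
    proof (intro exI allI impI)
      fix m n assume mn: "N \<le> m" "N \<le> n"
      have "norm (?X m - ?X n) \<le> 4 * E_bound * (2 / real (Suc m) + 2 / real (Suc n)) * norm f"
        by (rule d)
      also have "\<dots> \<le> 4 * E_bound * (2 / real (Suc N) + 2 / real (Suc N)) * norm f"
        using mn E_bound_nonneg
        by (intro mult_right_mono mult_left_mono add_mono divide_left_mono) auto
      finally show "norm (?X m - ?X n) < e" using N by linarith
    qed
  qed
  then show ?thesis
    unfolding bint_def by (simp add: Cauchy_convergent_iff convergent_LIMSEQ_iff)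
qed

text \<open>As the discretization error tends to 0, only the sup distance \<open>r\<close> survives.
  Hence every uniformly convergent simple sequence computes \<open>bint\<close>, and
  \<open>r = 0\<close> gives agreement on simple functions.\<close>

lemma norm_simple_bint_diff_le:
  assumes F: "bounded_borel F" and s: "simple_function borel s" and r: "\<And>z. cmod (s z - F z) \<le> r"
  shows "norm (simple_spectral_integral E s f - bint F f) \<le> 4 * E_bound * r * norm f"
proof (rule LIMSEQ_le)
  show "(\<lambda>n. norm (simple_spectral_integral E s f - simple_spectral_integral E (discretize n F) f))
    \<longlonglongrightarrow> norm (simple_spectral_integral E s f - bint F f)"
    by (intro tendsto_intros bint_discretize[OF F])
  have "(\<lambda>n. 2 / real (Suc n)) \<longlonglongrightarrow> 0"
    by (rule LIMSEQ_Suc[OF lim_const_over_n])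
  then have "(\<lambda>n. 4 * E_bound * (r + 2 / real (Suc n)) * norm f) \<longlonglongrightarrow> 4 * E_bound * (r + 0) * norm f"
    by (intro tendsto_intros)
  then show "(\<lambda>n. 4 * E_bound * (r + 2 / real (Suc n)) * norm f) \<longlonglongrightarrow> 4 * E_bound * r * norm f"
    by simp
  have "norm (simple_spectral_integral E s f - simple_spectral_integral E (discretize n F) f)
      \<le> 4 * E_bound * (r + 2 / real (Suc n)) * norm f" for n
  proof (rule norm_simple_spectral_integral_diff_le[OF s simple_function_discretize[OF F]])
    show "cmod (s z - discretize n F z) \<le> r + 2 / real (Suc n)" for z
      using norm_discretize_diff[of n F z] r[of z]
      by (metis norm_diff_triangle_le norm_minus_commute)
  qed
  then show "\<exists>N. \<forall>n\<ge>N. norm (simple_spectral_integral E s f - simple_spectral_integral E (discretize n F) f)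
      \<le> 4 * E_bound * (r + 2 / real (Suc n)) * norm f" by blast
qed

lemma bint_LIMSEQ:
  assumes F: "bounded_borel F" and s: "\<And>n. simple_function borel (s n)"
    and lim: "uniform_limit UNIV s F sequentially"
  shows "(\<lambda>n. simple_spectral_integral E (s n) f) \<longlonglongrightarrow> bint F f"
proof (rule tendstoI)
  fix e :: real assume e: "e > 0"
  \<comment> \<open>The summand 1 keeps the divisor positive when \<open>E_bound * norm f\<close> is
    0.\<close>
  let ?K = "4 * E_bound * norm f + 1"
  have K: "?K > 0" using E_bound_nonneg by (simp add: add_nonneg_pos)
  with e have "\<forall>\<^sub>F n in sequentially. \<forall>z\<in>UNIV. dist (s n z) (F z) < e / ?K"
    using lim by (intro uniform_limitD) auto
  then show "\<forall>\<^sub>F n in sequentially. dist (simple_spectral_integral E (s n) f) (bint F f) < e"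
  proof eventually_elim
    case (elim n)
    have "norm (simple_spectral_integral E (s n) f - bint F f) \<le> 4 * E_bound * (e / ?K) * norm f"
      using elim by (intro norm_simple_bint_diff_le F s) (auto simp: dist_norm less_imp_le)
    also have "\<dots> = (4 * E_bound * norm f) * (e / ?K)" by simp
    also have "\<dots> < ?K * (e / ?K)"
      using e K by (intro mult_strict_right_mono) auto
    also have "\<dots> = e" using K by simp
    finally show ?case by (simp add: dist_norm)
  qed
qed

lemma bint_simple: "simple_function borel s \<Longrightarrow> bint s f = simple_spectral_integral E s f"
  using norm_simple_bint_diff_le[of s s 0 f] simple_function_imp_bounded_borel[of s] by simp

lemma bint_add:
  assumes "bounded_borel F" "bounded_borel G"
  shows "bint (\<lambda>z. F z + G z) f = bint F f + bint G f"
proof (rule LIMSEQ_unique)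
  show "(\<lambda>n. simple_spectral_integral E (\<lambda>z. discretize n F z + discretize n G z) f)
    \<longlonglongrightarrow> bint (\<lambda>z. F z + G z) f"
    using assms simple_function_discretize
    by (intro bint_LIMSEQ bounded_borel_add uniform_limit_add uniform_limit_discretize) auto
  have "(\<lambda>n. simple_spectral_integral E (discretize n F) f + simple_spectral_integral E (discretize n G) f)
    \<longlonglongrightarrow> bint F f + bint G f"
    by (intro tendsto_add bint_discretize assms)
  then show "(\<lambda>n. simple_spectral_integral E (\<lambda>z. discretize n F z + discretize n G z) f)
    \<longlonglongrightarrow> bint F f + bint G f"
    using assms by (simp add: simple_spectral_integral_add simple_function_discretize)
qed

lemma norm_bint_le:
  assumes F: "bounded_borel F" and r: "\<And>z. cmod (F z) \<le> r"
  shows "norm (bint F f) \<le> 4 * E_bound * r * norm f"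
proof (rule LIMSEQ_le)
  show "(\<lambda>n. norm (simple_spectral_integral E (discretize n F) f)) \<longlonglongrightarrow> norm (bint F f)"
    by (intro tendsto_intros bint_discretize[OF F])
  have "(\<lambda>n. 2 / real (Suc n)) \<longlonglongrightarrow> 0"
    by (rule LIMSEQ_Suc[OF lim_const_over_n])
  then have "(\<lambda>n. 4 * E_bound * (r + 2 / real (Suc n)) * norm f) \<longlonglongrightarrow> 4 * E_bound * (r + 0) * norm f"
    by (intro tendsto_intros)
  then show "(\<lambda>n. 4 * E_bound * (r + 2 / real (Suc n)) * norm f) \<longlonglongrightarrow> 4 * E_bound * r * norm f"
    by simp
  have "norm (simple_spectral_integral E (discretize n F) f)
      \<le> 4 * E_bound * (r + 2 / real (Suc n)) * norm f" for n
  proof (rule norm_simple_spectral_integral_le[OF simple_function_discretize[OF F]])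
    show "cmod (discretize n F z) \<le> r + 2 / real (Suc n)" for z
      using norm_discretize_diff[of n F z] r[of z] norm_triangle_ineq2[of "discretize n F z" "F z"]
      by linarith
  qed
  then show "\<exists>N. \<forall>n\<ge>N. norm (simple_spectral_integral E (discretize n F) f)
      \<le> 4 * E_bound * (r + 2 / real (Suc n)) * norm f" by blast
qed

lemma bounded_clinear_bint:
  assumes F: "bounded_borel F"
  shows "bounded_clinear (bint F)"
proof -
  obtain r where r: "\<And>z. cmod (F z) \<le> r" using F by (rule bounded_borelE) blast
  have cl: "bounded_clinear (simple_spectral_integral E (discretize n F))" for n
    by (rule bounded_clinear_simple_spectral_integral[OF simple_function_discretize[OF F]])
  show ?thesis
  proof (rule bounded_clinearI)
    fix x y c
    have "(\<lambda>n. simple_spectral_integral E (discretize n F) x + simple_spectral_integral E (discretize n F) y)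
        \<longlonglongrightarrow> bint F x + bint F y"
      by (intro tendsto_add bint_discretize F)
    then have "(\<lambda>n. simple_spectral_integral E (discretize n F) (x + y)) \<longlonglongrightarrow> bint F x + bint F y"
      by (simp add: linear_simps[OF bounded_clinear_imp_bounded_linear[OF cl]])
    then show "bint F (x + y) = bint F x + bint F y"
      using bint_discretize[OF F] LIMSEQ_unique by blast
    have "(\<lambda>n. c *\<^sub>C simple_spectral_integral E (discretize n F) x) \<longlonglongrightarrow> c *\<^sub>C bint F x"
      by (intro scaleC.tendsto bint_discretize F tendsto_const)
    then have "(\<lambda>n. simple_spectral_integral E (discretize n F) (c *\<^sub>C x)) \<longlonglongrightarrow> c *\<^sub>C bint F x"
      by (simp add: bounded_clinear_scaleC[OF cl])
    then show "bint F (c *\<^sub>C x) = c *\<^sub>C bint F x"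
      using bint_discretize[OF F] LIMSEQ_unique by blast
    show "norm (bint F x) \<le> (4 * E_bound * r) * norm x"
      using F r by (rule norm_bint_le)
  qed
qed

lemma bounded_linear_bint: "bounded_borel F \<Longrightarrow> bounded_linear (bint F)"
  by (rule bounded_clinear_imp_bounded_linear[OF bounded_clinear_bint])

lemma bint_simple_mult:
  assumes s: "simple_function borel s" and G: "bounded_borel G"
  shows "bint (\<lambda>z. s z * G z) f = simple_spectral_integral E s (bint G f)"
proof (rule LIMSEQ_unique)
  have "bounded (range s)" using simple_functionD(1)[OF s] by (auto intro: finite_imp_bounded)
  moreover have "bounded (range G)" using G by (auto elim!: bounded_borelE simp: bounded_iff)
  ultimately show "(\<lambda>n. simple_spectral_integral E (\<lambda>z. s z * discretize n G z) f)
    \<longlonglongrightarrow> bint (\<lambda>z. s z * G z) f"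
    using s simple_function_discretize[OF G]
    by (intro bint_LIMSEQ bounded_borel_mult G simple_function_imp_bounded_borel
        uniform_lim_mult uniform_limit_discretize uniform_limit_const) auto
  have "(\<lambda>n. simple_spectral_integral E s (simple_spectral_integral E (discretize n G) f))
    \<longlonglongrightarrow> simple_spectral_integral E s (bint G f)"
    by (rule bounded_linear.tendsto[OF
        bounded_clinear_imp_bounded_linear[OF bounded_clinear_simple_spectral_integral[OF s]]
        bint_discretize[OF G]])
  then show "(\<lambda>n. simple_spectral_integral E (\<lambda>z. s z * discretize n G z) f)
    \<longlonglongrightarrow> simple_spectral_integral E s (bint G f)"
    using s by (simp add: simple_spectral_integral_mult simple_function_discretize G)
qed

lemma bint_cmult:
  assumes "bounded_borel F"
  shows "bint (\<lambda>z. c * F z) f = c *\<^sub>C bint F f"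
  using bint_simple_mult[of "\<lambda>z. c" F f] assms
  by (simp add: simple_spectral_integral_def E_UNIV)

lemma bint_diff:
  assumes "bounded_borel F" "bounded_borel G"
  shows "bint (\<lambda>z. F z - G z) f = bint F f - bint G f"
  using bint_add[OF assms(1) bounded_borel_mult[OF bounded_borel_const[of "-1"] assms(2)], of f]
    bint_cmult[OF assms(2), of "-1" f]
  by (simp add: scaleC.minus_left scaleC_one)

lemma norm_bint_diff_le:
  assumes "bounded_borel F" "bounded_borel G" and "\<And>z. cmod (F z - G z) \<le> r"
  shows "norm (bint F f - bint G f) \<le> 4 * E_bound * r * norm f"
  using norm_bint_le[OF bounded_borel_diff[OF assms(1,2)] assms(3)] bint_diff[OF assms(1,2)] by simp

text \<open>The factors are approximated one at a time: \<open>bint_simple_mult\<close> has already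
  passed to the limit in \<open>G\<close>, and now \<open>F\<close> is discretized, at an error of
  \<open>2 / Suc n\<close> times the bound \<open>q\<close> of \<open>G\<close>.\<close>

lemma bint_mult:
  assumes F: "bounded_borel F" and G: "bounded_borel G"
  shows "bint (\<lambda>z. F z * G z) f = bint F (bint G f)"
proof (rule LIMSEQ_unique)
  show "(\<lambda>n. simple_spectral_integral E (discretize n F) (bint G f)) \<longlonglongrightarrow> bint F (bint G f)"
    by (rule bint_discretize[OF F])
  obtain q where q: "0 \<le> q" "\<And>z. cmod (G z) \<le> q" using G by (rule bounded_borelE) blast
  show "(\<lambda>n. simple_spectral_integral E (discretize n F) (bint G f)) \<longlonglongrightarrow> bint (\<lambda>z. F z * G z) f"
  proof (rule Lim_transform_bound[OF always_eventually, THEN LIM_zero_cancel], rule allI)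
    fix n
    have "norm (bint (\<lambda>z. discretize n F z * G z) f - bint (\<lambda>z. F z * G z) f)
      \<le> 4 * E_bound * (2 / real (Suc n) * q) * norm f"
    proof (rule norm_bint_diff_le)
      show "cmod (discretize n F z * G z - F z * G z) \<le> 2 / real (Suc n) * q" for z
        unfolding left_diff_distrib[symmetric] norm_mult
        using norm_discretize_diff q by (intro mult_mono) auto
    qed (intro bounded_borel_mult F G simple_function_imp_bounded_borel simple_function_discretize)+
    also have "\<dots> \<le> norm (4 * E_bound * (2 / real (Suc n) * q) * norm f)"
      unfolding real_norm_def by (rule abs_ge_self)
    finally show "norm (simple_spectral_integral E (discretize n F) (bint G f) - bint (\<lambda>z. F z * G z) f)
      \<le> norm (4 * E_bound * (2 / real (Suc n) * q) * norm f)"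
      using F G by (simp add: bint_simple_mult simple_function_discretize)
  next
    have "(\<lambda>n. 2 / real (Suc n)) \<longlonglongrightarrow> 0"
      by (rule LIMSEQ_Suc[OF lim_const_over_n])
    then have "(\<lambda>n. 4 * E_bound * (2 / real (Suc n) * q) * norm f) \<longlonglongrightarrow> 4 * E_bound * (0 * q) * norm f"
      by (intro tendsto_intros)
    then show "(\<lambda>n. 4 * E_bound * (2 / real (Suc n) * q) * norm f) \<longlonglongrightarrow> 0" by simp
  qed
qed

lemma bint_indicator:
  assumes "\<delta> \<in> sets borel"
  shows "bint (indicator \<delta>) f = E \<delta> f"
proof -
  have s: "simple_function borel (indicator \<delta> :: complex \<Rightarrow> complex)"
    using assms by (intro simple_function_indicator)
  let ?i = "indicator \<delta> :: complex \<Rightarrow> complex"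
  \<comment> \<open>The set \<open>{0, 1}\<close> exceeds the range if \<open>\<delta>\<close> is
    empty or the whole plane, but an unattained value contributes nothing.\<close>
  have "simple_spectral_integral E ?i f = (\<Sum>c\<in>{0, 1}. c *\<^sub>C E (?i -` {c}) f)"
    unfolding simple_spectral_integral_def
  proof (rule sum.mono_neutral_left)
    show "\<forall>c\<in>{0, 1} - range ?i. c *\<^sub>C E (?i -` {c}) f = 0"
    proof
      fix c assume "c \<in> {0, 1} - range ?i"
      then have "?i -` {c} = {}" by auto
      then show "c *\<^sub>C E (?i -` {c}) f = 0" by (simp only: E_empty scaleC.zero_right)
    qed
  qed (auto simp: indicator_def)
  also have "\<dots> = E (?i -` {1}) f" by (simp add: scaleC_one scaleC.zero_left)
  also have "?i -` {1} = \<delta>" by (auto simp: indicator_def)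
  finally show ?thesis using bint_simple[OF s] by simp
qed

text \<open>The estimate for simple approximants is uniform in \<open>f\<close>, so every admissible
  sequence converges in operator norm. Conversely, the single sequence \<open>discretize\<close>
  already determines any competitor \<open>T\<close>.\<close>

lemma bounded_spectral_integral_eq_bint:
  assumes F: "bounded_borel F"
  shows "bounded_spectral_integral E F = bint F"
  unfolding bounded_spectral_integral_def
proof (rule the_equality, intro conjI allI impI)
  show "bounded_clinear (bint F)" by (rule bounded_clinear_bint[OF F])
  fix s :: "nat \<Rightarrow> complex \<Rightarrow> complex"
  assume s: "\<forall>n. simple_function borel (s n)" and lim: "uniform_limit UNIV s F sequentially"
  show "(\<lambda>n. onorm (\<lambda>f. simple_spectral_integral E (s n) f - bint F f)) \<longlonglongrightarrow> 0"
  proof (rule tendstoI)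
    fix e :: real assume e: "e > 0"
    let ?K = "4 * E_bound + 1"
    have K: "?K > 0" using E_bound_nonneg by (simp add: add_nonneg_pos)
    with e have "\<forall>\<^sub>F n in sequentially. \<forall>z\<in>UNIV. dist (s n z) (F z) < e / ?K"
      using lim by (intro uniform_limitD) auto
    then show "\<forall>\<^sub>F n in sequentially. dist (onorm (\<lambda>f. simple_spectral_integral E (s n) f - bint F f)) 0 < e"
    proof eventually_elim
      case (elim n)
      have b: "norm (simple_spectral_integral E (s n) f - bint F f) \<le> 4 * E_bound * (e / ?K) * norm f" for f
        using elim s by (intro norm_simple_bint_diff_le F) (auto simp: dist_norm less_imp_le)
      have "onorm (\<lambda>f. simple_spectral_integral E (s n) f - bint F f) \<le> 4 * E_bound * (e / ?K)"
        using b e K E_bound_nonneg by (intro onorm_bound) auto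
      also have "\<dots> < ?K * (e / ?K)"
        using e K by (intro mult_strict_right_mono) auto
      also have "\<dots> = e" using K by simp
      finally show ?case
        using s bounded_linear_bint[OF F]
        by (simp add: onorm_pos_le bounded_linear_sub bounded_clinear_simple_spectral_integral
            bounded_clinear_imp_bounded_linear)
    qed
  qed
next
  fix T assume T: "bounded_clinear T \<and> (\<forall>s. (\<forall>n. simple_function borel (s n)) \<longrightarrow>
    uniform_limit UNIV s F sequentially \<longrightarrow>
    (\<lambda>n. onorm (\<lambda>f. simple_spectral_integral E (s n) f - T f)) \<longlonglongrightarrow> 0)"
  let ?s = "\<lambda>n. discretize n F"
  have lim: "(\<lambda>n. onorm (\<lambda>f. simple_spectral_integral E (?s n) f - T f)) \<longlonglongrightarrow> 0"
    using T[THEN conjunct2, rule_format, of ?s] simple_function_discretize[OF F]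
      uniform_limit_discretize[of F] by simp
  show "T = bint F"
  proof
    fix f
    have "(\<lambda>n. simple_spectral_integral E (?s n) f) \<longlonglongrightarrow> T f"
    proof (rule Lim_transform_bound[OF always_eventually, THEN LIM_zero_cancel], rule allI)
      fix n
      have "bounded_linear (\<lambda>f. simple_spectral_integral E (?s n) f - T f)"
        using T bounded_clinear_simple_spectral_integral[OF simple_function_discretize[OF F]]
        by (intro bounded_linear_sub bounded_clinear_imp_bounded_linear) auto
      from onorm[OF this, of f]
      show "norm (simple_spectral_integral E (?s n) f - T f)
        \<le> norm (onorm (\<lambda>f. simple_spectral_integral E (?s n) f - T f) * norm f)" by simp
    next
      show "(\<lambda>n. onorm (\<lambda>f. simple_spectral_integral E (?s n) f - T f) * norm f) \<longlonglongrightarrow> 0"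
        using tendsto_mult_left_zero[OF lim] .
    qed
    then show "T f = bint F f" using bint_discretize[OF F] LIMSEQ_unique by blast
  qed
qed

end

section \<open>Spectral exponentials\<close>

text \<open>Fitted to the Taylor bound \<open>mexp_quadratic\<close>, and used for vector-valued as
  well as operator-valued curves.\<close>

lemma has_vector_derivative_quadraticI:
  fixes f :: "real \<Rightarrow> 'a::real_normed_vector"
  assumes "\<And>h. \<bar>h\<bar> \<le> 1 \<Longrightarrow> norm (f (x + h) - f x - h *\<^sub>R d) \<le> C * h\<^sup>2"
  shows "(f has_vector_derivative d) (at x)"
  unfolding has_vector_derivative_def has_derivative_at
proof (intro conjI bounded_linear_scaleR_left)
  show "(\<lambda>h. norm (f (x + h) - f x - h *\<^sub>R d) / norm h) \<midarrow>0\<rightarrow> 0"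
  proof (rule Lim_null_comparison)
    show "\<forall>\<^sub>F h in at 0. norm (norm (f (x + h) - f x - h *\<^sub>R d) / norm h) \<le> C * \<bar>h\<bar>"
      unfolding eventually_at
    proof (intro exI[of _ 1] conjI ballI impI)
      fix h :: real assume h: "h \<noteq> 0 \<and> dist h 0 < 1"
      then have "norm (f (x + h) - f x - h *\<^sub>R d) \<le> C * \<bar>h\<bar> * \<bar>h\<bar>"
        using assms[of h] by (simp add: power2_eq_square)
      then show "norm (norm (f (x + h) - f x - h *\<^sub>R d) / norm h) \<le> C * \<bar>h\<bar>"
        using h by (simp add: divide_le_eq)
    qed simp
    have "((\<lambda>h. C * \<bar>h\<bar>) \<longlongrightarrow> C * \<bar>0\<bar>) (at 0)"
      by (intro tendsto_intros)
    then show "((\<lambda>h. C * \<bar>h\<bar>) \<longlongrightarrow> 0) (at 0)" by simp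
  qed
qed

text \<open>The derivatives of \<open>y\<close> are known only to exist; uniqueness of derivatives
  identifies their images under \<open>L\<close> with an explicit chain \<open>d\<close>. With
  \<open>L\<close> a spectral projection this reads off one term of the series solution without
  differentiating the series.\<close>

lemma nth_derivative_on_bounded_linear:
  fixes y :: "real \<Rightarrow> 'a::real_normed_vector"
  assumes I: "open I" and y: "y \<in> smooth_functions_on I" and L: "bounded_linear L"
    and d0: "\<And>t. t \<in> I \<Longrightarrow> L (y t) = d 0 t"
    and d: "\<And>k t. t \<in> I \<Longrightarrow> (d k has_vector_derivative d (Suc k) t) (at t)"
    and t: "t \<in> I"
  shows "L (nth_derivative_on I y k t) = d k t"
  using t
proof (induction k arbitrary: t)
  case 0
  then show ?case using d0 by simp
next
  case (Suc k)
  have "nth_derivative_on I y k differentiable (at t within I)"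
    using y Suc.prems unfolding smooth_functions_on_def differentiable_on_def by blast
  then have "(nth_derivative_on I y k has_vector_derivative nth_derivative_on I y (Suc k) t) (at t within I)"
    unfolding nth_derivative_on.simps vector_derivative_works .
  then have "(nth_derivative_on I y k has_vector_derivative nth_derivative_on I y (Suc k) t) (at t)"
    by (rule has_vector_derivative_within_open[OF Suc.prems I, THEN iffD1])
  then have "((\<lambda>t. L (nth_derivative_on I y k t)) has_vector_derivative L (nth_derivative_on I y (Suc k) t)) (at t)"
    by (rule bounded_linear.has_vector_derivative[OF L])
  then have "(d k has_vector_derivative L (nth_derivative_on I y (Suc k) t)) (at t)"
    using I Suc.prems Suc.IH by (rule has_vector_derivative_transform_within_open)
  then show ?case
    using d[OF Suc.prems, of k] by (rule vector_derivative_unique_at)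
qed

text \<open>At \<open>k = m * n\<close> both factorials are replaced by powers: \<open>n!\<close>
  costs \<open>n ^ n\<close>, and the Gevrey factor costs \<open>(m powr b * n powr b) ^ n\<close>
  with \<open>b = \<beta> * m\<close>. After cancellation, \<open>n ^ n \<le> Q * P ^ n\<close>
  remains.\<close>

lemma gevrey_growth_contradiction:
  fixes \<alpha> \<beta> Q :: real
  assumes \<alpha>: "\<alpha> > 0" and \<beta>: "0 \<le> \<beta>" "\<beta> < 1" and inf: "infinite N"
    and bound: "\<And>n k. n \<in> N \<Longrightarrow> real n ^ k \<le> Q * fact n * exp (real n) * \<alpha> ^ k * fact k powr \<beta>"
  shows False
proof -
  obtain m :: nat where "2 / (1 - \<beta>) \<le> real m" using real_arch_simple by blast
  then have m: "2 + \<beta> * real m \<le> real m" using \<beta> by (simp add: field_simps)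
  then have mpos: "m > 0" using \<beta> by (cases m) auto
  \<comment> \<open>\<open>P\<close> collects what grows only exponentially in \<open>n\<close>: the
    contributions of \<open>exp\<close>, of \<open>\<alpha>\<close>, and of the factor
    \<open>m\<close> in the bound for \<open>(m * n)!\<close>.\<close>
  define P where "P = exp 1 * \<alpha> ^ m * real m powr (\<beta> * real m)"
  have P: "P > 0" using \<alpha> mpos by (simp add: P_def)
  \<comment> \<open>\<open>2 * P \<le> n\<close> will turn \<open>n ^ n \<le> Q * P ^ n\<close> into
    \<open>2 ^ n \<le> Q\<close>, and \<open>Q \<le> n\<close> then contradicts
    \<open>n < 2 ^ n\<close>.\<close>
  obtain n where n: "n \<in> N" "nat \<lceil>max (2 * P) (max Q 1)\<rceil> \<le> n"
    using inf infinite_nat_iff_unbounded_le by blast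
  have "max (2 * P) (max Q 1) \<le> real n" using n(2) by linarith
  then have n2: "2 * P \<le> real n" "Q \<le> real n" "1 \<le> real n" by auto
  define b where "b = \<beta> * real m"
  have f1: "fact n \<le> real n ^ n"
    using fact_le_power[of n] by simp
  have "fact (m * n) powr \<beta> \<le> (real (m * n) ^ (m * n)) powr \<beta>"
    using \<beta> fact_le_power[of "m * n", where 'a = real] by (intro powr_mono2) auto
  also have "\<dots> = (real (m * n) powr real (m * n)) powr \<beta>"
    using n2 mpos by (subst powr_realpow) auto
  also have "\<dots> = (real m powr b * real n powr b) powr real n"
    using n2 mpos by (simp add: powr_powr powr_mult b_def mult_ac)
  also have "\<dots> = (real m powr b * real n powr b) ^ n"
    using n2 mpos by (subst powr_realpow) auto
  finally have f2: "fact (m * n) powr \<beta> \<le> (real m powr b * real n powr b) ^ n" .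
  \<comment> \<open>The bound at \<open>k = 0\<close> has left side 1.\<close>
  have Q: "Q > 0"
  proof (rule ccontr)
    assume "\<not> Q > 0"
    then have "Q * (fact n * exp (real n) * (\<alpha> ^ 0 * fact 0 powr \<beta>)) \<le> 0"
      using \<alpha> by (intro mult_nonpos_nonneg) auto
    then show False using bound[OF n(1), of 0] by simp
  qed
  \<comment> \<open>Of the two spare factors \<open>n ^ n\<close>, one absorbs \<open>fact n\<close>
    and the other beats \<open>Q * P ^ n\<close>.\<close>
  have "(real n powr (2 + b)) ^ n \<le> (real n powr real m) ^ n"
    using m n2 by (intro power_mono powr_mono) (auto simp: b_def)
  also have "\<dots> = real n ^ (m * n)"
    using n2 by (simp add: powr_realpow power_mult)
  also have "\<dots> \<le> Q * fact n * exp (real n) * \<alpha> ^ (m * n) * fact (m * n) powr \<beta>"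
    by (rule bound[OF n(1)])
  also have "\<dots> \<le> Q * real n ^ n * exp (real n) * \<alpha> ^ (m * n) * (real m powr b * real n powr b) ^ n"
    using f1 f2 Q \<alpha> by (intro mult_mono) auto
  also have "exp (real n) = exp 1 ^ n" by (simp add: exp_of_nat_mult[symmetric])
  also have "Q * real n ^ n * exp 1 ^ n * \<alpha> ^ (m * n) * (real m powr b * real n powr b) ^ n
     = Q * (P * (real n * real n powr b)) ^ n"
    by (simp add: P_def b_def power_mult power_mult_distrib mult_ac)
  finally have "(real n * (real n * real n powr b)) ^ n \<le> Q * (P * (real n * real n powr b)) ^ n"
    using n2 by (simp add: powr_add power2_eq_square mult_ac)
  then have "real n ^ n * (real n * real n powr b) ^ n \<le> Q * P ^ n * (real n * real n powr b) ^ n"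
    by (simp add: power_mult_distrib mult_ac)
  moreover have "(real n * real n powr b) ^ n > 0" using n2 by simp
  ultimately have "real n ^ n \<le> Q * P ^ n" by (rule mult_right_le_imp_le)
  moreover have "(2 * P) ^ n \<le> real n ^ n" using n2 P by (intro power_mono) auto
  ultimately have "2 ^ n * P ^ n \<le> Q * P ^ n" by (simp add: power_mult_distrib)
  then have "2 ^ n \<le> Q" using P by simp
  also have "Q \<le> real n" by (rule n2)
  also have "real n < 2 ^ n" by (rule of_nat_less_two_power)
  finally show False by simp
qed

lemma norm_power_exp_le:
  fixes w z :: complex
  assumes "cmod w \<le> R"
  shows "cmod (w ^ k * exp (z * w)) \<le> R ^ k * exp (R * cmod z)"
proof -
  have R: "0 \<le> R" using assms norm_ge_zero order_trans by blast
  have "cmod (exp (z * w)) \<le> exp (cmod (z * w))" by (rule norm_exp)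
  also have "\<dots> \<le> exp (R * cmod z)" using assms by (simp add: norm_mult mult.commute mult_right_mono)
  finally show ?thesis
    using assms R by (simp add: norm_mult norm_power mult_mono power_mono)
qed

section \<open>Operator exponentials over bounded Borel sets\<close>

context resolution_of_identity
begin

text \<open>\<open>mexp B k z\<close> is the operator \<open>A\<^sup>k e\<^sup>z\<^sup>A E(B)\<close>.\<close>

definition mexp :: "complex set \<Rightarrow> nat \<Rightarrow> complex \<Rightarrow> 'a \<Rightarrow> 'a" where
  "mexp B k z = bint (\<lambda>w. indicator B w * (w ^ k * exp (z * w)))"

lemma bounded_borel_mexp:
  assumes "B \<in> sets borel" "B \<subseteq> cball 0 R"
  shows "bounded_borel (\<lambda>w. indicator B w * (w ^ k * exp (z * w)))"
  using assms norm_power_exp_le[of _ R k z]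
  by (intro bounded_borel_indicator_mult[where r = "R ^ k * exp (R * cmod z)"]
      borel_measurable_continuous_onI continuous_intros) auto

lemma bounded_clinear_mexp:
  "B \<in> sets borel \<Longrightarrow> B \<subseteq> cball 0 R \<Longrightarrow> bounded_clinear (mexp B k z)"
  unfolding mexp_def by (intro bounded_clinear_bint bounded_borel_mexp)

lemma norm_mexp_le:
  assumes "B \<in> sets borel" "B \<subseteq> cball 0 R" "0 \<le> R"
  shows "norm (mexp B k z f) \<le> 4 * E_bound * (R ^ k * exp (R * cmod z)) * norm f"
  unfolding mexp_def
proof (rule norm_bint_le[OF bounded_borel_mexp[OF assms(1,2)]])
  fix w
  show "cmod (indicator B w * (w ^ k * exp (z * w))) \<le> R ^ k * exp (R * cmod z)"
    using assms norm_power_exp_le[of w R k z]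
    by (cases "w \<in> B") (auto simp del: norm_mult)
qed

lemma mexp_mexp:
  assumes "B \<in> sets borel" "B \<subseteq> cball 0 R" "C \<in> sets borel" "C \<subseteq> cball 0 R"
  shows "mexp B j z (mexp C k u f) = mexp (B \<inter> C) (j + k) (z + u) f"
  unfolding mexp_def bint_mult[OF bounded_borel_mexp[OF assms(1,2)] bounded_borel_mexp[OF assms(3,4)], symmetric]
  by (simp add: indicator_inter_arith exp_add power_add ring_distribs mult_ac)

lemma E_mexp:
  assumes "B \<in> sets borel" "B \<subseteq> cball 0 R" "\<delta> \<in> sets borel"
  shows "E \<delta> (mexp B k z f) = mexp (\<delta> \<inter> B) k z f"
proof -
  have i: "bounded_borel (indicator \<delta>)"
    using assms by (intro bounded_borelI[of _ 1] borel_measurable_indicator) (auto simp: indicator_def)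
  show ?thesis
    unfolding mexp_def bint_indicator[OF assms(3), symmetric]
      bint_mult[OF i bounded_borel_mexp[OF assms(1,2)], symmetric]
    by (simp add: indicator_inter_arith mult_ac)
qed

lemma mexp_E:
  assumes "B \<in> sets borel" "B \<subseteq> cball 0 R" "\<delta> \<in> sets borel"
  shows "mexp B k z (E \<delta> f) = mexp (B \<inter> \<delta>) k z f"
proof -
  have i: "bounded_borel (indicator \<delta>)"
    using assms by (intro bounded_borelI[of _ 1] borel_measurable_indicator) (auto simp: indicator_def)
  show ?thesis
    unfolding mexp_def bint_indicator[OF assms(3), symmetric]
      bint_mult[OF bounded_borel_mexp[OF assms(1,2)] i, symmetric]
    by (simp add: indicator_inter_arith mult_ac)
qed

lemma mexp_0_0: "B \<in> sets borel \<Longrightarrow> mexp B 0 0 f = E B f"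
  by (simp add: mexp_def bint_indicator)

lemma mexp_empty: "mexp {} k z f = 0"
  using E_mexp[of "{}" 0 "{}" k z f] by (simp add: E_empty)

text \<open>Uniformity of the constant in \<open>f\<close> later yields a derivative in operator
  norm; complex \<open>h\<close> serves both complex differentiability and real time.\<close>

lemma mexp_quadratic:
  assumes B: "B \<in> sets borel" "B \<subseteq> cball 0 R" "0 \<le> R"
  shows "\<exists>C\<ge>0. \<forall>h f. cmod h \<le> 1 \<longrightarrow>
    norm (mexp B k (z + h) f - mexp B k z f - h *\<^sub>C mexp B (Suc k) z f) \<le> C * (cmod h)\<^sup>2 * norm f"
proof -
  \<comment> \<open>The first two factors bound \<open>w ^ k * exp (z * w)\<close> on the disc of
    radius \<open>R\<close>; \<open>exp R * R\<^sup>2\<close> comes from the Taylor remainder of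
    \<open>exp (h * w)\<close> for |h| \<le> 1.\<close>
  define c where "c = R ^ k * exp (R * cmod z) * (exp R * R\<^sup>2)"
  have c: "0 \<le> c" using B by (simp add: c_def)
  have "norm (mexp B k (z + h) f - mexp B k z f - h *\<^sub>C mexp B (Suc k) z f)
      \<le> 4 * E_bound * (c * (cmod h)\<^sup>2) * norm f" if h: "cmod h \<le> 1" for h f
  proof -
    let ?F = "\<lambda>k z w. indicator B w * (w ^ k * exp (z * w)) :: complex"
    note bb = bounded_borel_mexp[OF B(1,2)]
    have eq: "mexp B k (z + h) f - mexp B k z f - h *\<^sub>C mexp B (Suc k) z f
      = bint (\<lambda>w. ?F k (z + h) w - ?F k z w - h * ?F (Suc k) z w) f"
      unfolding mexp_def
      by (subst bint_diff bint_cmult, (intro bounded_borel_diff bounded_borel_mult bounded_borel_const bb)+)+ simp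
    show ?thesis
      unfolding eq
    proof (rule norm_bint_le)
      show "bounded_borel (\<lambda>w. ?F k (z + h) w - ?F k z w - h * ?F (Suc k) z w)"
        by (intro bounded_borel_diff bounded_borel_mult[of "\<lambda>_. h"] bounded_borel_const bb)
      fix w
      show "cmod (?F k (z + h) w - ?F k z w - h * ?F (Suc k) z w) \<le> c * (cmod h)\<^sup>2"
      proof (cases "w \<in> B")
        case True
        then have w: "cmod w \<le> R" using B by auto
        have "cmod (exp (h * w) - (\<Sum>i\<le>1. (h * w) ^ i / fact i)) \<le> exp \<bar>Re (h * w)\<bar> * (cmod (h * w)) ^ Suc 1 / fact 1"
          by (rule Taylor_exp)
        also have "\<dots> = exp \<bar>Re (h * w)\<bar> * ((cmod w)\<^sup>2 * (cmod h)\<^sup>2)"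
          by (simp add: norm_mult power2_eq_square mult_ac)
        also have "\<dots> \<le> exp R * (R\<^sup>2 * (cmod h)\<^sup>2)"
        proof (intro mult_mono)
          have "\<bar>Re (h * w)\<bar> \<le> cmod h * cmod w" using abs_Re_le_cmod[of "h * w"] by (simp add: norm_mult)
          also have "\<dots> \<le> 1 * R" using h w by (intro mult_mono) auto
          finally show "exp \<bar>Re (h * w)\<bar> \<le> exp R" by simp
        qed (use w in \<open>auto intro: power_mono\<close>)
        finally have t: "cmod (exp (h * w) - 1 - h * w) \<le> exp R * (R\<^sup>2 * (cmod h)\<^sup>2)"
          by (simp add: diff_diff_eq)
        have "?F k (z + h) w - ?F k z w - h * ?F (Suc k) z w
            = (w ^ k * exp (z * w)) * (exp (h * w) - 1 - h * w)"
          using True by (simp add: exp_add ring_distribs)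
        also have "cmod \<dots> \<le> (R ^ k * exp (R * cmod z)) * (exp R * (R\<^sup>2 * (cmod h)\<^sup>2))"
          unfolding norm_mult[of "w ^ k * exp (z * w)"]
          using t norm_power_exp_le[OF w] B by (intro mult_mono) auto
        finally show ?thesis by (simp add: c_def mult_ac)
      qed (use c in auto)
    qed
  qed
  then show ?thesis
    using c E_bound_nonneg by (intro exI[of _ "4 * E_bound * c"]) (auto simp: mult_ac)
qed

lemma mexp_complex_derivative:
  assumes B: "B \<in> sets borel" "B \<subseteq> cball 0 R" "0 \<le> R"
  shows "((\<lambda>h. inverse h *\<^sub>C (mexp B k (z + h) f - mexp B k z f)) \<longlongrightarrow> mexp B (Suc k) z f) (at 0)"
proof -
  obtain C where C: "\<And>h f. cmod h \<le> 1 \<Longrightarrow>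
    norm (mexp B k (z + h) f - mexp B k z f - h *\<^sub>C mexp B (Suc k) z f) \<le> C * (cmod h)\<^sup>2 * norm f"
    using mexp_quadratic[OF B, of k z] by auto
  show ?thesis
  proof (rule LIM_zero_cancel, rule Lim_null_comparison)
    show "\<forall>\<^sub>F h in at 0. norm (inverse h *\<^sub>C (mexp B k (z + h) f - mexp B k z f) - mexp B (Suc k) z f)
       \<le> C * norm f * cmod h"
      unfolding eventually_at
    proof (intro exI[of _ 1] conjI ballI impI)
      fix h :: complex assume h: "h \<noteq> 0 \<and> dist h 0 < 1"
      have "inverse h *\<^sub>C (mexp B k (z + h) f - mexp B k z f) - mexp B (Suc k) z f
        = inverse h *\<^sub>C (mexp B k (z + h) f - mexp B k z f - h *\<^sub>C mexp B (Suc k) z f)"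
        using h by (simp add: scaleC.diff_right scaleC_scaleC scaleC_one)
      also have "norm \<dots> \<le> inverse (cmod h) * (C * (cmod h)\<^sup>2 * norm f)"
        using h C[of h f] by (simp add: norm_scaleC norm_inverse mult_left_mono)
      also have "\<dots> = C * norm f * cmod h"
        using h by (simp add: power2_eq_square field_simps)
      finally show "norm (inverse h *\<^sub>C (mexp B k (z + h) f - mexp B k z f) - mexp B (Suc k) z f) \<le> C * norm f * cmod h" .
    qed simp
    have "((\<lambda>h::complex. C * norm f * cmod h) \<longlongrightarrow> C * norm f * cmod 0) (at 0)"
      by (intro tendsto_intros)
    then show "((\<lambda>h::complex. C * norm f * cmod h) \<longlongrightarrow> 0) (at 0)" by simp
  qed
qed

lemma mexp_has_vector_derivative:
  assumes B: "B \<in> sets borel" "B \<subseteq> cball 0 R" "0 \<le> R"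
  shows "((\<lambda>t. mexp B k (complex_of_real t) f) has_vector_derivative mexp B (Suc k) (complex_of_real t) f) (at t)"
proof -
  obtain C where C: "\<And>h f. cmod h \<le> 1 \<Longrightarrow>
    norm (mexp B k (of_real t + h) f - mexp B k (of_real t) f - h *\<^sub>C mexp B (Suc k) (of_real t) f) \<le> C * (cmod h)\<^sup>2 * norm f"
    using mexp_quadratic[OF B, of k "of_real t"] by auto
  show ?thesis
  proof (rule has_vector_derivative_quadraticI[where C = "C * norm f"])
    fix h :: real assume "\<bar>h\<bar> \<le> 1"
    then show "norm (mexp B k (of_real (t + h)) f - mexp B k (of_real t) f - h *\<^sub>R mexp B (Suc k) (of_real t) f) \<le> C * norm f * h\<^sup>2"
      using C[of "of_real h" f] by (simp add: scaleC_of_real mult_ac)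
  qed
qed

lemma entire_of_exponential_type_mexp:
  assumes S: "S \<in> sets borel" "S \<subseteq> cball 0 R" "0 \<le> R"
    and y: "\<And>t. 0 \<le> t \<Longrightarrow> y t = mexp S 0 (complex_of_real t) f"
  shows "entire_of_exponential_type y"
  unfolding entire_of_exponential_type_def
proof (intro exI[of _ "\<lambda>z. mexp S 0 z f"] conjI allI impI)
  show "entire_vector_function (\<lambda>z. mexp S 0 z f)"
    unfolding entire_vector_function_def using mexp_complex_derivative[OF S] by blast
  show "mexp S 0 (complex_of_real t) f = y t" if "0 \<le> t" for t using y[OF that] by simp
  show "\<exists>\<gamma>>0. \<exists>M>0. \<forall>z. norm (mexp S 0 z f) \<le> M * exp (\<gamma> * cmod z)"
  proof (intro exI conjI allI)
    \<comment> \<open>The increments by 1 make both constants strictly positive even if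
      \<open>R\<close> or \<open>f\<close> is 0.\<close>
    show "R + 1 > 0" "4 * E_bound * norm f + 1 > 0"
      using S(3) E_bound_nonneg by (auto intro!: add_nonneg_pos)
    fix z
    have "norm (mexp S 0 z f) \<le> (4 * E_bound * norm f) * exp (R * cmod z)"
      using norm_mexp_le[OF S, of 0 z f] by (simp add: mult_ac)
    also have "\<dots> \<le> (4 * E_bound * norm f + 1) * exp ((R + 1) * cmod z)"
      using E_bound_nonneg by (intro mult_mono) (auto simp: mult_right_mono)
    finally show "norm (mexp S 0 z f) \<le> (4 * E_bound * norm f + 1) * exp ((R + 1) * cmod z)" .
  qed
qed

text \<open>On the part of the space where the spectrum avoids the disc of radius \<open>\<rho>\<close>, the inverse of
  \<open>A\<^sup>k e\<^sup>z\<^sup>A\<close> is again a bounded spectral integral.\<close>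

lemma norm_E_le_mexp:
  assumes B: "B \<in> sets borel" "B \<subseteq> cball 0 R" and \<rho>: "0 < \<rho>" "\<And>w. w \<in> B \<Longrightarrow> \<rho> \<le> cmod w"
  shows "norm (E B f) \<le> 4 * E_bound * (exp (R * cmod z) / \<rho> ^ k) * norm (mexp B k z f)"
proof -
  let ?G = "\<lambda>w. indicator B w * (inverse w ^ k * exp (- z * w)) :: complex"
  have le: "cmod (inverse w ^ k * exp (- z * w)) \<le> exp (R * cmod z) / \<rho> ^ k" if w: "w \<in> B" for w
  proof -
    have wR: "cmod w \<le> R" using B w by auto
    have "cmod (w ^ 0 * exp (- z * w)) \<le> R ^ 0 * exp (R * cmod (- z))"
      by (rule norm_power_exp_le[OF wR])
    moreover have "inverse (cmod w ^ k) \<le> inverse (\<rho> ^ k)"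
      using \<rho>(1) \<rho>(2)[OF w] by (intro le_imp_inverse_le power_mono) auto
    ultimately have "inverse (cmod w ^ k) * cmod (exp (- z * w)) \<le> inverse (\<rho> ^ k) * exp (R * cmod z)"
      using \<rho>(1) by (intro mult_mono) auto
    then show ?thesis by (simp add: norm_mult norm_power norm_inverse power_inverse divide_inverse mult.commute)
  qed
  have m: "(\<lambda>w::complex. inverse w ^ k * exp (- z * w)) \<in> borel_measurable borel"
    by (intro borel_measurable_times borel_measurable_power borel_measurable_inverse measurable_ident_sets
        borel_measurable_continuous_onI[of "\<lambda>w. exp (- z * w)"] continuous_intros) auto
  have G: "bounded_borel ?G"
    by (rule bounded_borel_indicator_mult[OF B(1) m le])
  have "(\<lambda>w. ?G w * (indicator B w * (w ^ k * exp (z * w)))) = indicator B"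
  proof
    fix w
    show "?G w * (indicator B w * (w ^ k * exp (z * w))) = indicator B w"
    proof (cases "w \<in> B")
      case True
      \<comment> \<open>Since \<open>\<rho> > 0\<close>, the default value of \<open>inverse\<close>
        at 0 is never met on \<open>B\<close>.\<close>
      then have "w \<noteq> 0" using \<rho> by fastforce
      have "?G w * (indicator B w * (w ^ k * exp (z * w))) = (inverse w * w) ^ k * (exp (- z * w) * exp (z * w))"
        using True by (simp add: power_mult_distrib mult_ac del: left_inverse right_inverse)
      also have "\<dots> = 1" using \<open>w \<noteq> 0\<close> by (simp add: exp_add[symmetric])
      finally show ?thesis using True by simp
    qed simp
  qed
  then have "E B f = bint ?G (mexp B k z f)"
    unfolding mexp_def bint_mult[OF G bounded_borel_mexp[OF B], symmetric] by (simp add: bint_indicator[OF B(1)])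
  also have "norm \<dots> \<le> 4 * E_bound * (exp (R * cmod z) / \<rho> ^ k) * norm (mexp B k z f)"
    using le \<rho>(1) by (intro norm_bint_le[OF G]) (auto simp: indicator_def)
  finally show ?thesis .
qed

section \<open>The support and the truncated integrals defining the operator\<close>

lemma closed_spectral_measure_support: "closed (spectral_measure_support E)"
  unfolding spectral_measure_support_def by (rule closed_Inter) auto

text \<open>The complement of the support is a possibly uncountable union of null open sets;
  Lindelof reduces it to a countable one, where \<sigma>-additivity applies.\<close>

lemma E_compl_support: "E (- spectral_measure_support E) = (\<lambda>_. 0)"
proof -
  define F where "F = {U. open U \<and> E U = (\<lambda>_. 0)}"
  obtain F' where F': "F' \<subseteq> F" "countable F'" "\<Union>F' = \<Union>F"
    using Lindelof[of F] unfolding F_def by auto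
  have E0: "E {} = (\<lambda>_. 0)" by (auto simp: E_empty)
  \<comment> \<open>Adjoining the null set \<open>{}\<close> makes the countable family nonempty, so
    that the naturals can enumerate it.\<close>
  define u where "u = from_nat_into (insert {} F')"
  have r: "range u = insert {} F'"
    unfolding u_def using F'(2) by (intro range_from_nat_into) auto
  have u: "u n \<in> sets borel \<and> E (u n) = (\<lambda>_. 0)" for n
  proof -
    have "u n \<in> insert {} F'" using r by auto
    then show ?thesis using F'(1) E0 by (auto simp: F_def)
  qed
  then have "E (\<Union>n. u n) = (\<lambda>_. 0)" by (intro E_null_UN) auto
  moreover have "- spectral_measure_support E = \<Union>F"
  proof -
    have "\<Union>F = - \<Inter>(uminus ` F)" by auto
    also have "uminus ` F = {S. closed S \<and> E (- S) = (\<lambda>_. 0)}"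
    proof (intro set_eqI iffI)
      fix S assume "S \<in> {S. closed S \<and> E (- S) = (\<lambda>_. 0)}"
      then have "- S \<in> F" by (auto simp: F_def)
      then show "S \<in> uminus ` F" by (metis double_complement imageI)
    qed (auto simp: F_def closed_def)
    finally show ?thesis by (simp add: spectral_measure_support_def)
  qed
  moreover have "(\<Union>n. u n) = \<Union>F" using r F'(3) by auto
  ultimately show ?thesis by simp
qed

lemma bounded_spectral_integral_truncation:
  assumes "closed S"
  shows "bounded_spectral_integral E (spectral_truncation S (\<lambda>z. z) n) f = mexp (S \<inter> cball 0 (real n)) 1 0 f"
proof -
  have *: "spectral_truncation S (\<lambda>z. z) n = (\<lambda>w. indicator (S \<inter> cball 0 (real n)) w * (w ^ 1 * exp (0 * w)))"
    by (auto simp: spectral_truncation_def indicator_def)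
  have "bounded_borel (spectral_truncation S (\<lambda>z. z) n)"
    unfolding * using assms by (intro bounded_borel_mexp[of _ "real n"]) auto
  then show ?thesis
    by (simp add: bounded_spectral_integral_eq_bint mexp_def *)
qed

text \<open>Because \<open>E B f = f\<close>, a truncation acts on \<open>f\<close> only through its
  part in \<open>B\<close>; once \<open>n \<ge> R\<close> this part is all of \<open>B\<close>, and
  the defining sequence is constant.\<close>

lemma spectral_integral_on_bounded_part:
  assumes S: "closed S" and B: "B \<in> sets borel" "B \<subseteq> S" "B \<subseteq> cball 0 R" and f: "E B f = f"
  shows "f \<in> spectral_integral_domain E S (\<lambda>z. z)"
    and "spectral_integral E S (\<lambda>z. z) f = mexp B 1 0 f"
proof -
  let ?X = "\<lambda>n. bounded_spectral_integral E (spectral_truncation S (\<lambda>z. z) n) f"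
  have "\<forall>\<^sub>F n in sequentially. ?X n = mexp B 1 0 f"
    using eventually_ge_at_top[of "nat \<lceil>R\<rceil>"]
  proof eventually_elim
    case (elim n)
    then have "cball 0 R \<subseteq> (cball 0 (real n) :: complex set)" by (intro subset_cball) linarith
    then have "S \<inter> cball 0 (real n) \<inter> B = B" using B by auto
    then show ?case
      using S B(1) mexp_E[of "S \<inter> cball 0 (real n)" "real n" B 1 0 f]
      by (simp add: bounded_spectral_integral_truncation f)
  qed
  then have "?X \<longlonglongrightarrow> mexp B 1 0 f" by (rule tendsto_eventually)
  then show "f \<in> spectral_integral_domain E S (\<lambda>z. z)" "spectral_integral E S (\<lambda>z. z) f = mexp B 1 0 f"
    by (auto simp: spectral_integral_domain_def spectral_integral_def convergent_def limI)
qed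

end

section \<open>Weak solutions\<close>

text \<open>Two bounded functionals that agree on the dense set \<open>D\<close> coincide, so the
  definite description in \<open>adjoint_operator\<close> denotes.\<close>

lemma adjoint_operator:
  assumes dense: "closure D = UNIV" and g: "g \<in> adjoint_domain D A"
  shows "bounded_clinear (adjoint_operator D A g) \<and> (\<forall>f\<in>D. g (A f) = adjoint_operator D A g f)"
proof -
  obtain h where h: "bounded_clinear h \<and> (\<forall>f\<in>D. g (A f) = h f)"
    using g by (auto simp: adjoint_domain_def)
  show ?thesis
    unfolding adjoint_operator_def
  proof (rule theI[of _ h])
    show "bounded_clinear h \<and> (\<forall>f\<in>D. g (A f) = h f)" by (rule h)
    fix k assume k: "bounded_clinear k \<and> (\<forall>f\<in>D. g (A f) = k f)"
    have "closed {x. k x = h x}"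
      using h k by (intro closed_Collect_eq linear_continuous_on bounded_clinear_imp_bounded_linear) auto
    moreover have "D \<subseteq> {x. k x = h x}" using h k by auto
    ultimately have "closure D \<subseteq> {x. k x = h x}" by (rule closure_minimal[rotated])
    then show "k = h" using dense by auto
  qed
qed

section \<open>The operator and its spectral annuli\<close>

locale scalar_spectral_operator = resolution_of_identity E
  for E :: "complex set \<Rightarrow> 'a::complex_banach \<Rightarrow> 'a" +
  fixes D :: "'a set" and A :: "'a \<Rightarrow> 'a"
  assumes dense: "closure D = UNIV"
    and support: "spectral_measure_support E = spectrum D A"
    and domain: "D = spectral_integral_domain E (spectrum D A) (\<lambda>z. z)"
    and A_eq: "f \<in> D \<Longrightarrow> A f = spectral_integral E (spectrum D A) (\<lambda>z. z) f"
begin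

lemma closed_spectrum: "closed (spectrum D A)"
  using closed_spectral_measure_support support by simp

lemma E_compl_spectrum: "E (- spectrum D A) = (\<lambda>_. 0)"
  using E_compl_support support by simp

lemma A_on_bounded_part:
  assumes "B \<in> sets borel" "B \<subseteq> spectrum D A" "B \<subseteq> cball 0 R" "E B f = f"
  shows "f \<in> D" "A f = mexp B 1 0 f"
  using spectral_integral_on_bounded_part[OF closed_spectrum assms] domain A_eq by auto

text \<open>Intersecting with the spectrum brings the ranges of the projections into the domain, by
  \<open>A_on_bounded_part\<close>; half-open bounds keep the annuli disjoint while they still cover
  the spectrum.\<close>

definition annulus :: "nat \<Rightarrow> complex set" where
  "annulus n = spectrum D A \<inter> {w. real n \<le> cmod w \<and> cmod w < real n + 1}"

lemma borel_annulus: "annulus n \<in> sets borel"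
proof -
  have "{w :: complex. real n \<le> cmod w \<and> cmod w < real n + 1} = - ball 0 (real n) \<inter> ball 0 (real n + 1)"
    by auto
  then show ?thesis
    unfolding annulus_def using closed_spectrum by auto
qed

lemma annulus_subset: "annulus n \<subseteq> spectrum D A" "annulus n \<subseteq> cball 0 (real n + 1)"
  by (auto simp: annulus_def)

lemma annulus_disjoint: "m \<noteq> n \<Longrightarrow> annulus m \<inter> annulus n = {}"
  by (auto simp: annulus_def)

text \<open>The lemmas below ask only for norms at most 1, so \<open>e n\<close> may vanish at
  unwanted indices and the series runs over all \<open>n\<close>.\<close>

definition annular_solution :: "(nat \<Rightarrow> 'a) \<Rightarrow> real \<Rightarrow> 'a" where
  "annular_solution e t = (\<Sum>n. (1 / fact n) *\<^sub>R mexp (annulus n) 0 (complex_of_real t) (e n))"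

lemma annular_solution_terms:
  assumes "norm (e n) \<le> 1" "\<bar>t\<bar> \<le> T"
  shows "norm ((1 / fact n) *\<^sub>R mexp (annulus n) 0 (complex_of_real t) (e n))
    \<le> 4 * E_bound * exp T * (inverse (fact n) * exp T ^ n)"
proof -
  have "norm (mexp (annulus n) 0 (complex_of_real t) (e n))
     \<le> 4 * E_bound * ((real n + 1) ^ 0 * exp ((real n + 1) * cmod (of_real t))) * norm (e n)"
    by (rule norm_mexp_le[OF borel_annulus annulus_subset(2)]) simp
  also have "\<dots> \<le> 4 * E_bound * (1 * exp ((real n + 1) * T)) * 1"
    using assms E_bound_nonneg by (intro mult_mono) auto
  also have "exp ((real n + 1) * T) = exp T * exp T ^ n"
    by (simp add: exp_add ring_distribs exp_of_nat_mult)
  finally have "norm (mexp (annulus n) 0 (complex_of_real t) (e n)) \<le> 4 * E_bound * exp T * exp T ^ n"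
    by simp
  then show ?thesis
    by (simp add: field_simps)
qed

lemma annular_solution_summable: "summable (\<lambda>n. 4 * E_bound * exp T * (inverse (fact n) * exp T ^ n))"
  by (intro summable_mult summable_exp)

lemma annular_solution_sums:
  assumes "\<And>n. norm (e n) \<le> 1"
  shows "(\<lambda>n. (1 / fact n) *\<^sub>R mexp (annulus n) 0 (complex_of_real t) (e n)) sums annular_solution e t"
  unfolding annular_solution_def
  by (intro summable_sums summable_comparison_test[OF _ annular_solution_summable[of "\<bar>t\<bar>"]] exI allI impI
      annular_solution_terms assms order_refl)

lemma annular_solution_uniform_limit:
  assumes "\<And>n. norm (e n) \<le> 1"
  shows "uniform_limit {-T..T}
    (\<lambda>n t. \<Sum>i<n. (1 / fact i) *\<^sub>R mexp (annulus i) 0 (complex_of_real t) (e i)) (annular_solution e) sequentially"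
  unfolding annular_solution_def
  by (rule Weierstrass_m_test[OF annular_solution_terms annular_solution_summable[of T]]) (auto simp: assms)

text \<open>The series is differentiated term by term after applying \<open>g\<close>. The
  derivative of the \<open>n\<close>th scalar term is \<open>?h (?Y n s)\<close>, where
  \<open>?h\<close> is the adjoint image of \<open>g\<close>; as \<open>?h\<close> is bounded, the
  derivatives converge uniformly because the series itself does.\<close>

lemma weak_solution_annular_solution:
  assumes e: "\<And>n. E (annulus n) (e n) = e n" "\<And>n. norm (e n) \<le> 1"
  shows "weak_solution D A (annular_solution e)"
proof -
  let ?Y = "\<lambda>n t. (1 / fact n) *\<^sub>R mexp (annulus n) 0 (complex_of_real t) (e n)"
  have deriv: "(?Y n has_vector_derivative (1 / fact n) *\<^sub>R mexp (annulus n) 1 (complex_of_real t) (e n)) (at t)" for n t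
    unfolding One_nat_def
    by (intro bounded_linear.has_vector_derivative[OF bounded_linear_scaleR_right]
        mexp_has_vector_derivative[OF borel_annulus annulus_subset(2)]) simp
  \<comment> \<open>Reaching below 0 makes even \<open>t = 0\<close> an interior point, so two-sided
    statements are proved first and restricted at the end.\<close>
  have interior: "t \<in> interior {-(t + 1)..t + 1}" if "0 \<le> t" for t :: real
    using that by simp
  show ?thesis
    unfolding weak_solution_def
  proof (intro conjI ballI allI impI)
    show "continuous_on {0..} (annular_solution e)"
    proof (intro continuous_at_imp_continuous_on ballI)
      fix t :: real assume "t \<in> {0..}"
      then have t: "0 \<le> t" by simp
      have "continuous_on {-(t + 1)..t + 1} (annular_solution e)"
      proof (rule uniform_limit_theorem[OF _ annular_solution_uniform_limit[OF e(2)]])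
        have "continuous_on {-(t + 1)..t + 1} (?Y i)" for i
          using deriv by (intro continuous_at_imp_continuous_on ballI has_vector_derivative_continuous) auto
        then show "\<forall>\<^sub>F n in sequentially. continuous_on {-(t + 1)..t + 1} (\<lambda>t. \<Sum>i<n. ?Y i t)"
          by (intro always_eventually allI continuous_on_sum)
      qed simp
      then show "isCont (annular_solution e) t"
        using continuous_on_interior interior[OF t] by blast
    qed
  next
    fix g t assume g: "g \<in> adjoint_domain D A" and t: "0 \<le> (t :: real)"
    let ?h = "adjoint_operator D A g" and ?S = "{-(t + 1)..t + 1}"
    have h: "bounded_clinear ?h" "\<And>f. f \<in> D \<Longrightarrow> g (A f) = ?h f"
      using adjoint_operator[OF dense g] by auto
    have hl: "bounded_linear ?h" by (rule bounded_clinear_imp_bounded_linear[OF h(1)])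
    have gl: "bounded_linear g"
      using g by (auto simp: adjoint_domain_def intro: bounded_clinear_imp_bounded_linear)
    have gA: "g ((1 / fact n) *\<^sub>R mexp (annulus n) 1 (complex_of_real s) (e n)) = ?h (?Y n s)" for n s
    proof -
      let ?v = "mexp (annulus n) 0 (complex_of_real s) (e n)"
      have "E (annulus n) ?v = ?v"
        by (simp add: E_mexp[OF borel_annulus annulus_subset(2) borel_annulus])
      note v = A_on_bounded_part[OF borel_annulus annulus_subset this]
      have "A ?v = mexp (annulus n) 1 (complex_of_real s) (e n)"
        unfolding v(2) mexp_mexp[OF borel_annulus annulus_subset(2) borel_annulus annulus_subset(2)] by simp
      then have "g (mexp (annulus n) 1 (complex_of_real s) (e n)) = ?h ?v"
        using h(2)[OF v(1)] by simp
      then show ?thesis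
        by (simp add: linear_simps[OF gl] linear_simps[OF hl])
    qed
    have gY: "((\<lambda>s. g (?Y n s)) has_vector_derivative ?h (?Y n s)) (at s)" for n s
      using bounded_linear.has_vector_derivative[OF gl deriv[of n s]] unfolding gA .
    have "\<exists>G. \<forall>s\<in>?S. (\<lambda>n. g (?Y n s)) sums G s \<and>
        (G has_derivative (\<lambda>d. d *\<^sub>R ?h (annular_solution e s))) (at s within ?S)"
    proof (rule has_derivative_series)
      show "convex ?S" by simp
      show "((\<lambda>s. g (?Y n s)) has_derivative (\<lambda>d. d *\<^sub>R ?h (?Y n s))) (at s within ?S)" for n s
        using gY[of n s] unfolding has_vector_derivative_def by (rule has_derivative_at_withinI)
      show "t \<in> ?S" using t by simp
      show "(\<lambda>n. g (?Y n t)) sums g (annular_solution e t)"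
        by (rule bounded_linear.sums[OF gl annular_solution_sums[OF e(2)]])
      fix \<epsilon> :: real assume \<epsilon>: "\<epsilon> > 0"
      have "uniform_limit ?S (\<lambda>n s. ?h (\<Sum>i<n. ?Y i s)) (\<lambda>s. ?h (annular_solution e s)) sequentially"
        by (rule bounded_linear.uniform_limit[OF hl annular_solution_uniform_limit[OF e(2)]])
      from uniform_limitD[OF this \<epsilon>]
      show "\<forall>\<^sub>F n in sequentially. \<forall>s\<in>?S. \<forall>d.
        norm ((\<Sum>i<n. d *\<^sub>R ?h (?Y i s)) - d *\<^sub>R ?h (annular_solution e s)) \<le> \<epsilon> * norm d"
      proof eventually_elim
        case (elim n)
        show ?case
        proof (intro ballI allI)
          fix s d assume "s \<in> ?S"
          with elim have "norm (?h (\<Sum>i<n. ?Y i s) - ?h (annular_solution e s)) \<le> \<epsilon>"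
            by (auto simp: dist_norm less_imp_le)
          then have "\<bar>d\<bar> * norm (?h (\<Sum>i<n. ?Y i s) - ?h (annular_solution e s)) \<le> \<bar>d\<bar> * \<epsilon>"
            by (intro mult_left_mono) auto
          then have "norm (d *\<^sub>R (?h (\<Sum>i<n. ?Y i s) - ?h (annular_solution e s))) \<le> \<epsilon> * norm d"
            by (simp add: mult.commute)
          then show "norm ((\<Sum>i<n. d *\<^sub>R ?h (?Y i s)) - d *\<^sub>R ?h (annular_solution e s)) \<le> \<epsilon> * norm d"
            unfolding linear_sum[OF bounded_linear.linear[OF hl]] scaleR_sum_right[symmetric]
              scaleR_diff_right[symmetric] .
        qed
      qed
    qed
    then obtain G where G: "\<And>s. s \<in> ?S \<Longrightarrow> (\<lambda>n. g (?Y n s)) sums G s"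
      "\<And>s. s \<in> ?S \<Longrightarrow> (G has_derivative (\<lambda>d. d *\<^sub>R ?h (annular_solution e s))) (at s within ?S)"
      by blast
    have tS: "t \<in> ?S" using t by simp
    \<comment> \<open>Termwise differentiation only provides some sum function \<open>G\<close>;
      uniqueness of sums identifies it.\<close>
    have "g (annular_solution e s) = G s" if "s \<in> ?S" for s
      using bounded_linear.sums[OF gl annular_solution_sums[OF e(2)], of s] G(1)[OF that]
      by (rule sums_unique2)
    then have "((\<lambda>s. g (annular_solution e s)) has_derivative (\<lambda>d. d *\<^sub>R ?h (annular_solution e t))) (at t within ?S)"
      using tS by (intro has_derivative_transform[OF _ _ G(2)]) auto
    then have "((\<lambda>s. g (annular_solution e s)) has_vector_derivative ?h (annular_solution e t)) (at t)"
      unfolding has_vector_derivative_def at_within_interior[OF interior[OF t]] .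
    then show "((\<lambda>s. g (annular_solution e s)) has_vector_derivative ?h (annular_solution e t)) (at t within {0..})"
      by (rule has_vector_derivative_at_within)
  qed
qed

text \<open>The projection passes through the series by continuity, and disjointness of the annuli
  leaves one term.\<close>

lemma E_annular_solution:
  assumes e: "\<And>n. norm (e n) \<le> 1"
  shows "E (annulus n) (annular_solution e t) = (1 / fact n) *\<^sub>R mexp (annulus n) 0 (complex_of_real t) (e n)"
proof (rule sums_unique2)
  let ?Y = "\<lambda>m. (1 / fact m) *\<^sub>R mexp (annulus m) 0 (complex_of_real t) (e m)"
  show "(\<lambda>m. E (annulus n) (?Y m)) sums E (annulus n) (annular_solution e t)"
    by (rule bounded_linear.sums[OF bounded_linear_E[OF borel_annulus] annular_solution_sums[OF e]])
  have *: "E (annulus n) (?Y m) = (1 / fact m) *\<^sub>R mexp (annulus n \<inter> annulus m) 0 (complex_of_real t) (e m)" for m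
    by (simp add: linear_simps[OF bounded_linear_E[OF borel_annulus]]
        E_mexp[OF borel_annulus annulus_subset(2) borel_annulus])
  have "E (annulus n) (?Y m) = 0" if "m \<noteq> n" for m
    unfolding * using annulus_disjoint[of n m] that by (simp add: mexp_empty)
  then have "(\<lambda>m. E (annulus n) (?Y m)) sums (\<Sum>m\<in>{n}. E (annulus n) (?Y m))"
    by (intro sums_finite) auto
  then show "(\<lambda>m. E (annulus n) (?Y m)) sums ?Y n"
    by (simp add: *)
qed

section \<open>Boundedness of the spectrum\<close>

lemma bounded_spectrum:
  assumes gevrey: "\<And>y. weak_solution D A y \<Longrightarrow> \<exists>\<beta>. 0 \<le> \<beta> \<and> \<beta> < 1 \<and> y \<in> roumieu_gevrey_class \<beta> {0<..}"
  shows "\<exists>R\<ge>0. spectrum D A \<subseteq> cball 0 R"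
proof (cases "finite {n. E (annulus n) \<noteq> (\<lambda>_. 0)}")
  case True
  then obtain N where N: "\<And>n. N \<le> n \<Longrightarrow> E (annulus n) = (\<lambda>_. 0)"
    by (metis (mono_tags, lifting) finite_nat_set_iff_bounded mem_Collect_eq not_less)
  \<comment> \<open>A countable null cover of the exterior of the disc of radius \<open>N\<close>:
    the complement of the spectrum, then the outer annuli. The exterior being null, the disc is one
    of the closed sets whose intersection is the support.\<close>
  define \<delta> where "\<delta> n = (case n of 0 \<Rightarrow> - spectrum D A | Suc m \<Rightarrow> annulus (N + m))" for n
  have \<delta>: "\<delta> n \<in> sets borel \<and> E (\<delta> n) = (\<lambda>_. 0)" for n
    using closed_spectrum borel_annulus E_compl_spectrum N by (cases n) (auto simp: \<delta>_def)
  have cover: "- cball 0 (real N) \<subseteq> (\<Union>n. \<delta> n)"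
  proof
    fix w :: complex assume w: "w \<in> - cball 0 (real N)"
    show "w \<in> (\<Union>n. \<delta> n)"
    proof (cases "w \<in> spectrum D A")
      case True
      define m where "m = nat \<lfloor>cmod w\<rfloor>"
      have m: "real m \<le> cmod w" "cmod w < real m + 1" unfolding m_def by (simp, linarith)
      then have "N \<le> m" using w by simp
      then have "w \<in> \<delta> (Suc (m - N))"
        using True m by (simp add: \<delta>_def annulus_def)
      then show ?thesis by blast
    next
      case False
      then have "w \<in> \<delta> 0" by (simp add: \<delta>_def)
      then show ?thesis by blast
    qed
  qed
  have "E (\<Union>n. \<delta> n) = (\<lambda>_. 0)" using \<delta> by (intro E_null_UN) auto
  then have "E (- cball 0 (real N)) = (\<lambda>_. 0)"
    by (rule E_null_subset[OF _ cover]) (use \<delta> in auto)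
  then have "spectral_measure_support E \<subseteq> cball 0 (real N)"
    unfolding spectral_measure_support_def by (intro Inter_lower) simp
  then show ?thesis using support by (intro exI[of _ "real N"]) simp
next
  case False
  \<comment> \<open>Index 0 is dropped because \<open>norm_E_le_mexp\<close> needs a positive inner
    radius \<open>real n\<close>.\<close>
  define N where "N = {n. E (annulus n) \<noteq> (\<lambda>_. 0)} - {0}"
  have N: "infinite N" using False by (simp add: N_def)
  have "\<exists>x. E (annulus n) x = x \<and> norm x \<le> 1 \<and> (n \<in> N \<longrightarrow> norm x = 1)" for n
  proof (cases "n \<in> N")
    case True
    then obtain x where x: "E (annulus n) x \<noteq> 0" by (auto simp: N_def fun_eq_iff)
    let ?v = "(1 / norm (E (annulus n) x)) *\<^sub>R E (annulus n) x"
    have "E (annulus n) ?v = ?v"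
      by (simp add: linear_simps[OF bounded_linear_E[OF borel_annulus]] E_E borel_annulus)
    moreover have "norm ?v = 1" using x by simp
    ultimately show ?thesis by (intro exI[of _ ?v]) simp
  next
    case False
    then show ?thesis
      by (intro exI[of _ 0]) (simp add: linear_simps[OF bounded_linear_E[OF borel_annulus]])
  qed
  then obtain e where e: "\<And>n. E (annulus n) (e n) = e n" "\<And>n. norm (e n) \<le> 1" "\<And>n. n \<in> N \<Longrightarrow> norm (e n) = 1"
    by metis
  let ?y = "annular_solution e"
  have "weak_solution D A ?y" using e(1,2) by (rule weak_solution_annular_solution)
  then obtain \<beta> where \<beta>: "0 \<le> \<beta>" "\<beta> < 1" "?y \<in> roumieu_gevrey_class \<beta> {0<..}"
    using gevrey by blast
  then have smooth: "?y \<in> smooth_functions_on {0<..}" by (simp add: roumieu_gevrey_class_def)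
  \<comment> \<open>A one-point interval: only the derivatives at time 1 are estimated.\<close>
  have "\<exists>\<alpha>>0. \<exists>c>0. \<forall>k. \<forall>t\<in>{1..1}.
      norm (nth_derivative_on {0<..} ?y k t) \<le> c * \<alpha> ^ k * fact k powr \<beta>"
  proof -
    have "{1..1} \<subseteq> {0::real<..}" by auto
    then show ?thesis using \<beta>(3) unfolding roumieu_gevrey_class_def by blast
  qed
  then obtain \<alpha> c where \<alpha>: "\<alpha> > 0" and
    c: "\<And>k. norm (nth_derivative_on {0<..} ?y k 1) \<le> c * \<alpha> ^ k * fact k powr \<beta>"
    by auto
  \<comment> \<open>\<open>4 * E_bound\<close> is the price of inverting \<open>mexp\<close> on the
    annulus, the other \<open>E_bound\<close> that of projecting the derivative;
    \<open>exp 1 * exp (real n)\<close> comes from the outer radius \<open>n + 1\<close> at time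
    1.\<close>
  have "real n ^ k \<le> (4 * E_bound * E_bound * c * exp 1) * fact n * exp (real n) * \<alpha> ^ k * fact k powr \<beta>"
    if n: "n \<in> N" for n k
  proof -
    have npos: "0 < real n" using n by (simp add: N_def)
    have "E (annulus n) (nth_derivative_on {0<..} ?y k 1)
        = (1 / fact n) *\<^sub>R mexp (annulus n) k (complex_of_real 1) (e n)"
    proof (rule nth_derivative_on_bounded_linear[OF _ smooth bounded_linear_E[OF borel_annulus], where
        d = "\<lambda>k t. (1 / fact n) *\<^sub>R mexp (annulus n) k (complex_of_real t) (e n)"])
      show "((\<lambda>t. (1 / fact n) *\<^sub>R mexp (annulus n) k (complex_of_real t) (e n)) has_vector_derivative
        (1 / fact n) *\<^sub>R mexp (annulus n) (Suc k) (complex_of_real t) (e n)) (at t)" for k t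
        by (intro bounded_linear.has_vector_derivative[OF bounded_linear_scaleR_right]
            mexp_has_vector_derivative[OF borel_annulus annulus_subset(2)]) simp
    qed (simp_all add: E_annular_solution e)
    then have "mexp (annulus n) k 1 (e n) = fact n *\<^sub>R E (annulus n) (nth_derivative_on {0<..} ?y k 1)"
      by simp
    then have "norm (mexp (annulus n) k 1 (e n)) = fact n * norm (E (annulus n) (nth_derivative_on {0<..} ?y k 1))"
      by simp
    also have "\<dots> \<le> fact n * (E_bound * norm (nth_derivative_on {0<..} ?y k 1))"
      by (intro mult_left_mono norm_E_le borel_annulus) simp
    also have "\<dots> \<le> fact n * (E_bound * (c * \<alpha> ^ k * fact k powr \<beta>))"
      using E_bound_nonneg by (intro mult_left_mono c) auto
    finally have le: "norm (mexp (annulus n) k 1 (e n)) \<le> fact n * (E_bound * (c * \<alpha> ^ k * fact k powr \<beta>))" .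
    have "1 = norm (E (annulus n) (e n))" using e n by simp
    also have "\<dots> \<le> 4 * E_bound * (exp ((real n + 1) * cmod 1) / real n ^ k) * norm (mexp (annulus n) k 1 (e n))"
      using npos by (intro norm_E_le_mexp borel_annulus annulus_subset) (auto simp: annulus_def)
    also have "\<dots> \<le> 4 * E_bound * (exp ((real n + 1) * cmod 1) / real n ^ k) * (fact n * (E_bound * (c * \<alpha> ^ k * fact k powr \<beta>)))"
      using E_bound_nonneg npos by (intro mult_left_mono le) auto
    finally have "1 * real n ^ k \<le> 4 * E_bound * (exp ((real n + 1) * cmod 1) / real n ^ k) * (fact n * (E_bound * (c * \<alpha> ^ k * fact k powr \<beta>))) * real n ^ k"
      using npos by (intro mult_right_mono) auto
    also have "\<dots> = 4 * E_bound * exp (real n + 1) * (fact n * (E_bound * (c * \<alpha> ^ k * fact k powr \<beta>)))"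
      using npos by simp
    finally show ?thesis by (simp add: exp_add mult_ac)
  qed
  then have False
    by (rule gevrey_growth_contradiction[OF \<alpha> \<beta>(1,2) N])
  then show ?thesis ..
qed

text \<open>The regularity hypothesis makes the Hahn--Banach theorem unnecessary: a vector \<open>v\<close> that is
  annihilated by all functionals would turn \<open>t \<mapsto> \<bar>t - 1\<bar> v\<close> into a weak solution.\<close>

lemma functionals_separate:
  assumes gevrey: "\<And>y. weak_solution D A y \<Longrightarrow> \<exists>\<beta>. 0 \<le> \<beta> \<and> \<beta> < 1 \<and> y \<in> roumieu_gevrey_class \<beta> {0<..}"
    and v: "\<And>g :: 'a \<Rightarrow> complex. bounded_clinear g \<Longrightarrow> g v = 0"
  shows "v = 0"
proof -
  let ?y = "\<lambda>t :: real. \<bar>t - 1\<bar> *\<^sub>R v"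
  have z: "g (?y t) = 0" if "bounded_clinear g" for g :: "'a \<Rightarrow> complex" and t
    using v[OF that] by (simp add: linear_simps[OF bounded_clinear_imp_bounded_linear[OF that]])
  have "weak_solution D A ?y"
    unfolding weak_solution_def
  proof (intro conjI ballI allI impI)
    show "continuous_on {0..} ?y" by (intro continuous_intros)
    fix g t assume g: "g \<in> adjoint_domain D A"
    then have "bounded_clinear g" by (simp add: adjoint_domain_def)
    moreover have "bounded_clinear (adjoint_operator D A g)" using adjoint_operator[OF dense g] by simp
    ultimately show "((\<lambda>s. g (?y s)) has_vector_derivative adjoint_operator D A g (?y t)) (at t within {0..})"
      by (simp only: z has_vector_derivative_const)
  qed
  then have "?y \<in> smooth_functions_on {0<..}"
    using gevrey by (auto simp: roumieu_gevrey_class_def)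
  then have "nth_derivative_on {0<..} ?y 0 differentiable_on {0<..}"
    unfolding smooth_functions_on_def by blast
  then have "?y differentiable (at 1 within {0<..})"
    unfolding differentiable_on_def by simp
  then have "?y differentiable (at 1)" by (simp add: at_within_open[of 1 "{0<..}"])
  then obtain d where d: "(?y has_vector_derivative d) (at 1)"
    by (auto simp: vector_derivative_works)
  \<comment> \<open>The slopes on the two sides of the kink are \<open>v\<close> and
    \<open>- v\<close>, and each must equal the derivative \<open>d\<close>.\<close>
  have "d = v"
  proof (rule vector_derivative_unique_within)
    show "(?y has_vector_derivative d) (at 1 within {1..})" using d by (rule has_vector_derivative_at_within)
    have "((\<lambda>t. (t - 1) *\<^sub>R v) has_vector_derivative v) (at 1 within {1..})"
      by (auto intro!: derivative_eq_intros)
    then show "(?y has_vector_derivative v) (at 1 within {1..})"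
      by (rule has_vector_derivative_transform[rotated 2]) auto
    show "at (1::real) within {1..} \<noteq> bot" by (simp add: at_within_Ici_at_right)
  qed
  moreover have "d = - v"
  proof (rule vector_derivative_unique_within)
    show "(?y has_vector_derivative d) (at 1 within {..1})" using d by (rule has_vector_derivative_at_within)
    have "((\<lambda>t. (1 - t) *\<^sub>R v) has_vector_derivative - v) (at 1 within {..1})"
      by (auto intro!: derivative_eq_intros)
    then show "(?y has_vector_derivative - v) (at 1 within {..1})"
      by (rule has_vector_derivative_transform[rotated 2]) auto
    show "at (1::real) within {..1} \<noteq> bot" by (simp add: at_within_Iic_at_left)
  qed
  ultimately show "v = 0" by (metis add.right_inverse real_vector.scale_eq_0_iff scaleR_2 zero_neq_numeral)
qed

section \<open>Weak solutions when the spectrum is bounded\<close>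

lemma domain_bounded_spectrum:
  assumes R: "spectrum D A \<subseteq> cball 0 R"
  shows "E (spectrum D A) f = f" "D = UNIV" "A f = mexp (spectrum D A) 1 0 f"
proof -
  have b: "spectrum D A \<in> sets borel" using closed_spectrum by auto
  have *: "E (spectrum D A) f = f" for f
    using E_Un_disjoint[of "spectrum D A" "- spectrum D A" f] b E_compl_spectrum
    by (simp add: E_UNIV sup_compl_top)
  show "E (spectrum D A) f = f" by (rule *)
  show "D = UNIV" "A f = mexp (spectrum D A) 1 0 f"
    using A_on_bounded_part[OF b order_refl R *] by auto
qed

text \<open>Separation of points turns the weak equation into \<open>y' = A y\<close> for positive
  times; the integrating factor \<open>e^(-sA)\<close> then makes \<open>q\<close> constant.\<close>

lemma weak_solution_eq_mexp:
  assumes R: "spectrum D A \<subseteq> cball 0 R" "0 \<le> R"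
    and gevrey: "\<And>y. weak_solution D A y \<Longrightarrow> \<exists>\<beta>. 0 \<le> \<beta> \<and> \<beta> < 1 \<and> y \<in> roumieu_gevrey_class \<beta> {0<..}"
    and y: "weak_solution D A y" and t: "0 \<le> t"
  shows "y t = mexp (spectrum D A) 0 (complex_of_real t) (y 0)"
proof -
  define S where "S = spectrum D A"
  have S: "S \<in> sets borel" "S \<subseteq> cball 0 R" using closed_spectrum R by (auto simp: S_def)
  have bl: "bounded_linear (mexp S k z)" for k z
    by (rule bounded_clinear_imp_bounded_linear[OF bounded_clinear_mexp[OF S]])
  have A: "A = mexp S 1 0" using domain_bounded_spectrum(3)[OF R(1)] by (auto simp: S_def)
  have D: "D = UNIV" by (rule domain_bounded_spectrum(2)[OF R(1)])
  have mm: "mexp S j z (mexp S k u f) = mexp S (j + k) (z + u) f" for j k z u f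
    using mexp_mexp[OF S S] by simp
  have y': "(y has_vector_derivative A (y s)) (at s)" if s: "0 < s" for s
  proof -
    have "y \<in> smooth_functions_on {0<..}"
      using gevrey[OF y] by (auto simp: roumieu_gevrey_class_def)
    then have "nth_derivative_on {0<..} y 0 differentiable_on {0<..}"
      unfolding smooth_functions_on_def by blast
    then have "y differentiable (at s within {0<..})"
      unfolding differentiable_on_def using s by simp
    then have "y differentiable (at s)" using s by (simp add: at_within_open[of s "{0<..}"])
    then obtain d where d: "(y has_vector_derivative d) (at s)"
      by (auto simp: vector_derivative_works)
    have "g (d - A (y s)) = 0" if g: "bounded_clinear g" for g :: "'a \<Rightarrow> complex"
    proof -
      have gl: "bounded_linear g" by (rule bounded_clinear_imp_bounded_linear[OF g])
      \<comment> \<open>As \<open>A\<close> is now a bounded operator, composing with it puts every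
        bounded functional into the domain of the adjoint.\<close>
      have gA: "bounded_clinear (\<lambda>f. g (A f))"
        unfolding A by (rule bounded_clinear_comp[OF g bounded_clinear_mexp[OF S]])
      then have ga: "g \<in> adjoint_domain D A" using g unfolding adjoint_domain_def by blast
      have "((\<lambda>s. g (y s)) has_vector_derivative adjoint_operator D A g (y s)) (at s within {0..})"
        using y ga s unfolding weak_solution_def by auto
      then have "((\<lambda>s. g (y s)) has_vector_derivative g (A (y s))) (at s within {0..})"
        using adjoint_operator[OF dense ga] D by (metis UNIV_I)
      then have "((\<lambda>s. g (y s)) has_vector_derivative g (A (y s))) (at s)"
        using at_within_interior[of s "{0..}"] s by simp
      moreover have "((\<lambda>s. g (y s)) has_vector_derivative g d) (at s)"
        by (rule bounded_linear.has_vector_derivative[OF gl d])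
      ultimately have "g d = g (A (y s))" using vector_derivative_unique_at by blast
      then show ?thesis by (simp add: linear_simps[OF gl])
    qed
    then have "d - A (y s) = 0" using functionals_separate[OF gevrey] by blast
    then show ?thesis using d by simp
  qed
  \<comment> \<open>The product rule for \<open>blinfun_apply\<close> requires \<open>U\<close> to
    be differentiable in operator norm, which the constant of \<open>mexp_quadratic\<close>, uniform
    in \<open>f\<close>, provides.\<close>
  define U where "U k s = Blinfun (mexp S k (complex_of_real (- s)))" for k and s :: real
  have U_apply: "blinfun_apply (U k s) f = mexp S k (complex_of_real (- s)) f" for k s f
    by (simp only: U_def bounded_linear_Blinfun_apply[OF bl])
  have U': "(U 0 has_vector_derivative - U 1 s) (at s)" for s
  proof -
    obtain C where C: "C \<ge> 0" "\<And>h f. cmod h \<le> 1 \<Longrightarrow>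
      norm (mexp S 0 (of_real (- s) + h) f - mexp S 0 (of_real (- s)) f - h *\<^sub>C mexp S (Suc 0) (of_real (- s)) f)
        \<le> C * (cmod h)\<^sup>2 * norm f"
      using mexp_quadratic[OF S R(2), of 0 "of_real (- s)"] by auto
    show ?thesis
    proof (rule has_vector_derivative_quadraticI[where C = C])
      fix h :: real assume h: "\<bar>h\<bar> \<le> 1"
      show "norm (U 0 (s + h) - U 0 s - h *\<^sub>R - U 1 s) \<le> C * h\<^sup>2"
      proof (rule norm_blinfun_bound)
        fix f
        show "norm (blinfun_apply (U 0 (s + h) - U 0 s - h *\<^sub>R - U 1 s) f) \<le> C * h\<^sup>2 * norm f"
          using C(2)[of "of_real (- h)" f] h
          by (simp add: blinfun.bilinear_simps U_apply scaleC.minus_left scaleC_of_real)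
      qed (use C in simp)
    qed
  qed
  define q where "q s = blinfun_apply (U 0 s) (y s)" for s
  have q': "(q has_vector_derivative 0) (at s)" if "0 < s" for s
  proof -
    have "(q has_vector_derivative blinfun_apply (U 0 s) (A (y s)) + blinfun_apply (- U 1 s) (y s)) (at s)"
      unfolding q_def
      by (rule bounded_bilinear.has_vector_derivative[OF bounded_bilinear_blinfun_apply U' y'[OF that]])
    also have "blinfun_apply (U 0 s) (A (y s)) + blinfun_apply (- U 1 s) (y s) = 0"
      by (simp add: blinfun.bilinear_simps U_apply A mm)
    finally show ?thesis .
  qed
  have cq: "continuous_on {0..t} q"
    unfolding q_def
  proof (rule bounded_bilinear.continuous_on[OF bounded_bilinear_blinfun_apply])
    show "continuous_on {0..t} (U 0)"
      using U' by (intro continuous_at_imp_continuous_on ballI has_vector_derivative_continuous) auto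
    show "continuous_on {0..t} y"
      using y by (auto simp: weak_solution_def intro: continuous_on_subset)
  qed
  have "q t = q 0"
  \<comment> \<open>The derivative is known only for positive times; at the exceptional point 0
    continuity is enough.\<close>
  proof (rule has_derivative_zero_unique_strong_interval[of "{0}" 0 t])
    fix s assume "s \<in> {0..t} - {0}"
    then show "(q has_derivative (\<lambda>h. 0)) (at s within {0..t})"
      using q'[of s] has_derivative_at_withinI unfolding has_vector_derivative_def by fastforce
  qed (use cq t in auto)
  then have "mexp S 0 (of_real (- t)) (y t) = mexp S 0 (of_real (- 0)) (y 0)"
    unfolding q_def U_apply .
  \<comment> \<open>Applying \<open>e^(tA)\<close> undoes the integrating factor, because
    \<open>mexp S 0 0\<close> is \<open>E S\<close>, the identity.\<close>
  then have "mexp S 0 (of_real t) (mexp S 0 (of_real (- t)) (y t)) = mexp S 0 (of_real t) (mexp S 0 0 (y 0))"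
    by simp
  then show ?thesis
    unfolding mm by (simp add: mexp_0_0 S_def[symmetric] S domain_bounded_spectrum(1)[OF R(1), folded S_def])
qed

end

theorem theorem4p1:
  fixes D :: "'a::complex_banach set" and A :: "'a \<Rightarrow> 'a"
  assumes "scalar_type_spectral_operator D A"
    and "\<And>y. weak_solution D A y \<Longrightarrow>
           \<exists>\<beta>. 0 \<le> \<beta> \<and> \<beta> < 1 \<and> y \<in> roumieu_gevrey_class \<beta> {0<..}"
  shows "bounded_operator D A \<and> (\<forall>y. weak_solution D A y \<longrightarrow> entire_of_exponential_type y)"
proof -
  obtain E where E: "spectral_measure E" "spectral_measure_support E = spectrum D A"
      "D = spectral_integral_domain E (spectrum D A) (\<lambda>z. z)"
      "\<forall>f\<in>D. A f = spectral_integral E (spectrum D A) (\<lambda>z. z) f"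
    and dense: "closure D = UNIV"
    using assms(1) unfolding scalar_type_spectral_operator_def densely_defined_closed_operator_def
    by blast
  interpret scalar_spectral_operator E D A
    using E dense by unfold_locales auto
  obtain R where R: "spectrum D A \<subseteq> cball 0 R" "0 \<le> R"
    using bounded_spectrum[OF assms(2)] by blast
  have S: "spectrum D A \<in> sets borel" using closed_spectrum by auto
  have A: "A = mexp (spectrum D A) 1 0" using domain_bounded_spectrum(3)[OF R(1)] by auto
  have "bounded_clinear A"
    using bounded_clinear_mexp[OF S R(1), of 1 0] unfolding A[symmetric] .
  then have "bounded_operator D A"
    using domain_bounded_spectrum(2)[OF R(1)] by (simp add: bounded_operator_def)
  moreover have "entire_of_exponential_type y" if "weak_solution D A y" for y
    using S R by (rule entire_of_exponential_type_mexp) (rule weak_solution_eq_mexp[OF R assms(2) that])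
  ultimately show ?thesis by blast
qed

end
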